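(* Let $\mathcal{G}^{\bowtie}=(G_1,\dots,G_d)^{\bowtie}$ be a surface loop graph. Then $L(\mathcal{G}^{\bowtie})$ is isomorphic to the lattice $\mathcal{J}(Q_{\mathcal{G}^{\bowtie}})$ of order ideals of the poset $Q_{\mathcal{G}^{\bowtie}}$; specifically, the isomorphism is given by sending a good matching $P$ to its height $h(P)$.
   Context: A tile is an axis-parallel square with edges $N,E,S,W$ and a diagonal from its NW to its SE corner (not an edge of the graph). A snake graph $\mathcal{G}=(G_1,\dots,G_d)$ is a sequence of tiles where the north or east edge of $G_i$ is glued to the south or west edge of $G_{i+1}$, along exactly one edge. A loop with respect to $G_1$ and $k\in\{2,\dots,d\}$: let $c'$ be the edge of $\{S(G_k),W(G_k)\}$ not shared with $G_{k-1}$, $y'$ the SW vertex of $G_k$, $x'$ the other endpoint of $c'$; let $c$ be an edge of $\{S(G_1),W(G_1)\}$, $x$ the SW vertex of $G_1$, $y$ the other endpoint of $c$; glue $c$ to $c'$ with $x\sim x'$, $y\sim y'$ (the cut edge). A loop w.r.t. $G_d$ and $k\in\{1,\dots,d-1\}$ is analogous with $N,E$ and NE vertices. A loop graph $\mathcal{G}^{\bowtie}$ has a loop w.r.t. $G_1$ and $k_1$ (none if $k_1=1$) and w.r.t. $G_d$ and $k_2$ (none if $k_2=d$). A good matching of $\mathcal{G}^{\bowtie}$ is a perfect matching that extends to a perfect matching of $\mathcal{G}$ (uniquely); it orients each diagonal via the walk from the SW vertex of $G_1$ to the NE vertex of $G_d$ alternating between matching edges and diagonals. A surface loop graph is one arising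 as follows: $T$ an ideal triangulation of a bordered surface, $\gamma$ a tagged arc with plain version not in $T$ and not notched at a puncture enclosed by a self-folded triangle of $T$; replacing each notched end at a puncture $p$ by a hook (going once around $p$ crossing each arc of $T$ at $p$ once before/after following $\gamma$) gives a hooked arc whose Musiker–Schiffler–Williams snake graph $(G_1,\dots,G_d)$ (one tile per crossing with $T$) contains the snake graph of the plain arc as $(G_{k_1},\dots,G_{k_2})$; the surface loop graph has loops w.r.t. $G_1,k_1$ and $G_d,k_2$, with glued edges carrying the same label. Tiles carry relative orientations alternating in sign; throughout, $rel(G_1)=1$, so $rel(G_j)=(-1)^{j+1}$. The diagonal of $G_j$ is positive w.r.t. $P$ if it is oriented down and $rel(G_j)=1$, or up and $rel(G_j)=-1$. The height $h(P)\subseteq\{1,\dots,d\}$ is the set of $i$ such that the diagonal of $G_i$ is positive w.r.t. $P$. Positive twist: $P'$ is obtained from a good matching $P$ by a positive twist at $G_j$ if $P\setminus\{N(G_j),S(G_j)\}=P'\setminus\{W(G_j),E(G_j)\}$ and $j$ is odd, or $P\setminus\{W(G_j),E(G_j)\}=P'\setminus\{N(G_j),S(G_j)\}$ and $j$ is even. $L(\mathcal{G}^{\bowtie})$ is the quiver whose vertices are the good matchings, with an arrow $P\to P'$ iff $P'$ is obtained from $P$ by a positive twist. $Q_{\mathcal{G}}$: vertices $1,\dots,d$, arrow $i\to i+1$ iff ($i$ odd and $G_{i+1}$ right of $G_i$) or ($i$ even and $G_{i+1}$ on top of $G_i$), arrow $i\to i-1$ iff ($i$ odd and $G_i$ right of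 $G_{i-1}$) or ($i$ even and $G_i$ on top of $G_{i-1}$). $Q_{\mathcal{G}^{\bowtie}}$ adds one arrow per loop: for a loop w.r.t. $G_1$ and $k$, $1\to k$ if ($k$ odd and the cut edge of $G_k$ is $S(G_k)$) or ($k$ even and it is $W(G_k)$), else $k\to1$; for a loop w.r.t. $G_d$ and $k$, $d\to k$ if ($k$ odd and the cut edge of $G_k$ is $N(G_k)$) or ($k$ even and it is $E(G_k)$), else $k\to d$. The poset on $\{1,\dots,d\}$: $i\le j$ iff $i=j$ or there is a directed path from $i$ to $j$ in $Q_{\mathcal{G}^{\bowtie}}$. An order ideal is a subset $I$ with $x\in I,\ y\le x\Rightarrow y\in I$; $\mathcal{J}(Q_{\mathcal{G}^{\bowtie}})$ is the lattice of order ideals ordered by inclusion. *)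

theory Defs
  imports "HOL-Analysis.Analysis"
begin

section \<open>Snake graphs and loop graphs\<close>

datatype compass = North | East | South | West

text \<open>
  A loop graph with tiles \<open>1, \<dots>, ntiles\<close>.  The tile \<open>j + 1\<close> is glued to the east edge of
  tile \<open>j\<close> if \<open>right j\<close> and to its north edge otherwise (\<open>1 \<le> j < ntiles\<close>).
  There is a loop with respect to tile 1 and tile \<open>k1\<close>, unless \<open>k1 = 1\<close>, and a loop with
  respect to tile \<open>ntiles\<close> and tile \<open>k2\<close>, unless \<open>k2 = ntiles\<close>.
  \<open>cut1\<close> is the position in tile 1 of the edge that is glued by the first loop and
  \<open>cut2\<close> the position in the last tile of the edge glued by the second one; they are
  meaningless if the loop is absent.
\<close>

record loop_graph =
  ntiles :: nat
  right :: "nat \<Rightarrow> bool"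
  k1 :: nat
  k2 :: nat
  cut1 :: compass
  cut2 :: compass

type_synonym vertex = "nat \<times> nat"
type_synonym edge = "vertex set"

definition tiles :: "loop_graph \<Rightarrow> nat set" where
  "tiles G = {1..ntiles G}"

text \<open>
  The underlying snake graph is drawn in the integer grid; \<open>sw G j\<close> is the south-west vertex
  of tile \<open>j\<close>.  The drawing only moves right and up, so tiles overlap in the grid exactly as
  they do in the glued graph.
\<close>

fun sw :: "loop_graph \<Rightarrow> nat \<Rightarrow> vertex" where
  "sw G 0 = (0, 0)"
| "sw G (Suc 0) = (0, 0)"
| "sw G (Suc (Suc j)) =
     (let (x, y) = sw G (Suc j) in if right G (Suc j) then (x + 1, y) else (x, y + 1))"

definition se :: "loop_graph \<Rightarrow> nat \<Rightarrow> vertex" where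
  "se G j = (fst (sw G j) + 1, snd (sw G j))"

definition nw :: "loop_graph \<Rightarrow> nat \<Rightarrow> vertex" where
  "nw G j = (fst (sw G j), snd (sw G j) + 1)"

definition ne :: "loop_graph \<Rightarrow> nat \<Rightarrow> vertex" where
  "ne G j = (fst (sw G j) + 1, snd (sw G j) + 1)"

fun tile_edge :: "loop_graph \<Rightarrow> nat \<Rightarrow> compass \<Rightarrow> edge" where
  "tile_edge G j North = {nw G j, ne G j}"
| "tile_edge G j East = {se G j, ne G j}"
| "tile_edge G j South = {sw G j, se G j}"
| "tile_edge G j West = {sw G j, nw G j}"

definition diagonal :: "loop_graph \<Rightarrow> nat \<Rightarrow> vertex set" where
  "diagonal G j = {nw G j, se G j}"

definition snake_vertices :: "loop_graph \<Rightarrow> vertex set" where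
  "snake_vertices G = (\<Union>j\<in>tiles G. {sw G j, se G j, nw G j, ne G j})"

definition snake_edges :: "loop_graph \<Rightarrow> edge set" where
  "snake_edges G = {tile_edge G j s | j s. j \<in> tiles G}"

definition snake_perfect_matching :: "loop_graph \<Rightarrow> edge set \<Rightarrow> bool" where
  "snake_perfect_matching G P \<longleftrightarrow>
     P \<subseteq> snake_edges G \<and> (\<forall>v\<in>snake_vertices G. \<exists>!e. e \<in> P \<and> v \<in> e)"

definition has_loop1 :: "loop_graph \<Rightarrow> bool" where
  "has_loop1 G \<longleftrightarrow> k1 G \<noteq> 1"

definition has_loop2 :: "loop_graph \<Rightarrow> bool" where
  "has_loop2 G \<longleftrightarrow> k2 G \<noteq> ntiles G"

text \<open>
  The position of the cut edge in tile \<open>k1\<close>: the one of south and west that is not shared with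
  the preceding tile; in tile \<open>k2\<close>: the one of north and east that is not shared with the
  following tile.
\<close>

definition inner_cut1 :: "loop_graph \<Rightarrow> compass" where
  "inner_cut1 G = (if right G (k1 G - 1) then South else West)"

definition inner_cut2 :: "loop_graph \<Rightarrow> compass" where
  "inner_cut2 G = (if right G (k2 G) then North else East)"

text \<open>
  The endpoint of a tile edge other than the south-west vertex (for south and west edges)
  or other than the north-east vertex (for north and east edges).
\<close>

definition far_end :: "loop_graph \<Rightarrow> nat \<Rightarrow> compass \<Rightarrow> vertex" where
  "far_end G j s = (if s = South \<or> s = East then se G j else nw G j)"

text \<open>
  Note the crosswise identification: the south-west (north-east) vertex of the outer tile goes
  to the far end of the cut edge of the inner tile, and conversely.
\<close>

definition glued_vertices :: "loop_graph \<Rightarrow> (vertex \<times> vertex) set" where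
  "glued_vertices G =
     (if has_loop1 G
      then {(sw G 1, far_end G (k1 G) (inner_cut1 G)), (far_end G 1 (cut1 G), sw G (k1 G))}
      else {}) \<union>
     (if has_loop2 G
      then {(ne G (ntiles G), far_end G (k2 G) (inner_cut2 G)),
            (far_end G (ntiles G) (cut2 G), ne G (k2 G))}
      else {})"

definition cut_pairs :: "loop_graph \<Rightarrow> (edge \<times> edge) set" where
  "cut_pairs G =
     (if has_loop1 G
      then {(tile_edge G 1 (cut1 G), tile_edge G (k1 G) (inner_cut1 G))} else {}) \<union>
     (if has_loop2 G
      then {(tile_edge G (ntiles G) (cut2 G), tile_edge G (k2 G) (inner_cut2 G))} else {})"

definition vertex_rel :: "loop_graph \<Rightarrow> (vertex \<times> vertex) set" where
  "vertex_rel G = (glued_vertices G \<union> (glued_vertices G)\<inverse>)\<^sup>*"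

definition edge_rel :: "loop_graph \<Rightarrow> (edge \<times> edge) set" where
  "edge_rel G = (cut_pairs G \<union> (cut_pairs G)\<inverse>)\<^sup>*"

text \<open>
  The loop graph itself is the quotient graph: its vertices and edges are the classes of
  vertices and edges of the snake graph.  (Edges have to be classes of edges, rather than pairs
  of vertex classes, because the quotient can have parallel edges.)
\<close>

definition loop_vertices :: "loop_graph \<Rightarrow> vertex set set" where
  "loop_vertices G = snake_vertices G // vertex_rel G"

definition loop_edges :: "loop_graph \<Rightarrow> edge set set" where
  "loop_edges G = snake_edges G // edge_rel G"

definition incident :: "vertex set \<Rightarrow> edge set \<Rightarrow> bool" where
  "incident X F \<longleftrightarrow> (\<exists>v\<in>X. \<exists>e\<in>F. v \<in> e)"

definition edge_class :: "loop_graph \<Rightarrow> edge \<Rightarrow> edge set" where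
  "edge_class G e = edge_rel G `` {e}"

abbreviation tile_class :: "loop_graph \<Rightarrow> nat \<Rightarrow> compass \<Rightarrow> edge set" where
  "tile_class G j s \<equiv> edge_class G (tile_edge G j s)"

definition loop_perfect_matching :: "loop_graph \<Rightarrow> edge set set \<Rightarrow> bool" where
  "loop_perfect_matching G P \<longleftrightarrow>
     P \<subseteq> loop_edges G \<and> (\<forall>X\<in>loop_vertices G. \<exists>!F. F \<in> P \<and> incident X F)"

text \<open>
  Cutting a loop open turns the cut edge into two copies \<open>c\<close>, \<open>c'\<close> and creates two new vertices.
  A perfect matching \<open>P\<close> of the loop graph extends to the perfect matching \<open>Q\<close> of the snake
  graph if \<open>Q\<close> arises from \<open>P\<close> by adding, for each loop, one copy of its cut edge: the second
  copy if the cut edge lies in \<open>P\<close>, and one of the two copies otherwise.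
\<close>

definition extends_to :: "loop_graph \<Rightarrow> edge set set \<Rightarrow> edge set \<Rightarrow> bool" where
  "extends_to G P Q \<longleftrightarrow>
     snake_perfect_matching G Q \<and>
     (\<forall>e\<in>snake_edges G - Field (cut_pairs G). e \<in> Q \<longleftrightarrow> edge_class G e \<in> P) \<and>
     (\<forall>(c, c')\<in>cut_pairs G.
        if edge_class G c \<in> P then c \<in> Q \<and> c' \<in> Q else (c \<in> Q) \<noteq> (c' \<in> Q))"

definition good_matching :: "loop_graph \<Rightarrow> edge set set \<Rightarrow> bool" where
  "good_matching G P \<longleftrightarrow> loop_perfect_matching G P \<and> (\<exists>Q. extends_to G P Q)"

definition good_matchings :: "loop_graph \<Rightarrow> edge set set set" where
  "good_matchings G = {P. good_matching G P}"

section \<open>Heights and twists\<close>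

text \<open>
  \<open>w 0, w 1, \<dots>, w (2 d + 1)\<close> is the walk from the south-west vertex of the first tile to the
  north-east vertex of the last tile, which traverses alternately edges of \<open>Q\<close> and diagonals.
\<close>

definition diagonal_walk :: "loop_graph \<Rightarrow> edge set \<Rightarrow> (nat \<Rightarrow> vertex) \<Rightarrow> bool" where
  "diagonal_walk G Q w \<longleftrightarrow>
     w 0 = sw G 1 \<and> w (2 * ntiles G + 1) = ne G (ntiles G) \<and>
     (\<forall>i\<le>ntiles G. {w (2 * i), w (2 * i + 1)} \<in> Q) \<and>
     (\<forall>i\<in>tiles G. {w (2 * i - 1), w (2 * i)} = diagonal G i)"

definition oriented_down :: "loop_graph \<Rightarrow> edge set set \<Rightarrow> nat \<Rightarrow> bool" where
  "oriented_down G P i \<longleftrightarrow>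
     (\<exists>Q w. extends_to G P Q \<and> diagonal_walk G Q w \<and>
            w (2 * i - 1) = nw G i \<and> w (2 * i) = se G i)"

definition oriented_up :: "loop_graph \<Rightarrow> edge set set \<Rightarrow> nat \<Rightarrow> bool" where
  "oriented_up G P i \<longleftrightarrow>
     (\<exists>Q w. extends_to G P Q \<and> diagonal_walk G Q w \<and>
            w (2 * i - 1) = se G i \<and> w (2 * i) = nw G i)"

definition rel :: "nat \<Rightarrow> int" where
  "rel j = (- 1) ^ (j + 1)"

definition positive_diagonal :: "loop_graph \<Rightarrow> edge set set \<Rightarrow> nat \<Rightarrow> bool" where
  "positive_diagonal G P i \<longleftrightarrow>
     (oriented_down G P i \<and> rel i = 1) \<or> (oriented_up G P i \<and> rel i = - 1)"

definition height :: "loop_graph \<Rightarrow> edge set set \<Rightarrow> nat set" where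
  "height G P = {i \<in> tiles G. positive_diagonal G P i}"

definition replace_edges :: "edge set set \<Rightarrow> edge set set \<Rightarrow> edge set set \<Rightarrow> edge set set \<Rightarrow> bool" where
  "replace_edges A B P P' \<longleftrightarrow> A \<subseteq> P \<and> B \<subseteq> P' \<and> P - A = P' - B"

definition positive_twist_at :: "loop_graph \<Rightarrow> nat \<Rightarrow> edge set set \<Rightarrow> edge set set \<Rightarrow> bool" where
  "positive_twist_at G j P P' \<longleftrightarrow>
     (let NS = {tile_class G j North, tile_class G j South};
          WE = {tile_class G j West, tile_class G j East}
      in (odd j \<and> replace_edges NS WE P P') \<or> (even j \<and> replace_edges WE NS P P'))"

text \<open>The set of arrows of the quiver \<open>L(G)\<close>, whose vertex set is \<open>good_matchings G\<close>.\<close>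

definition twist_arrows :: "loop_graph \<Rightarrow> (edge set set \<times> edge set set) set" where
  "twist_arrows G =
     {(P, P'). good_matching G P \<and> good_matching G P' \<and>
               (\<exists>j\<in>tiles G. positive_twist_at G j P P')}"

section \<open>The poset of a loop graph\<close>

definition snake_quiver :: "loop_graph \<Rightarrow> (nat \<times> nat) set" where
  "snake_quiver G =
     {(i, i + 1) | i. i \<in> tiles G \<and> i + 1 \<in> tiles G \<and>
        (odd i \<and> right G i \<or> even i \<and> \<not> right G i)} \<union>
     {(i, i - 1) | i. i \<in> tiles G \<and> i - 1 \<in> tiles G \<and>
        (odd i \<and> right G (i - 1) \<or> even i \<and> \<not> right G (i - 1))}"

definition loop_quiver :: "loop_graph \<Rightarrow> (nat \<times> nat) set" where
  "loop_quiver G = snake_quiver G \<union>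
     (if has_loop1 G then
        (if odd (k1 G) \<and> inner_cut1 G = South \<or> even (k1 G) \<and> inner_cut1 G = West
         then {(1, k1 G)} else {(k1 G, 1)}) else {}) \<union>
     (if has_loop2 G then
        (if odd (k2 G) \<and> inner_cut2 G = North \<or> even (k2 G) \<and> inner_cut2 G = East
         then {(ntiles G, k2 G)} else {(k2 G, ntiles G)}) else {})"

text \<open>In the poset, \<open>y \<le> x\<close> iff there is a directed (possibly empty) path from \<open>y\<close> to \<open>x\<close>.\<close>

definition order_ideals :: "loop_graph \<Rightarrow> nat set set" where
  "order_ideals G =
     {I. I \<subseteq> tiles G \<and> (\<forall>x\<in>I. \<forall>y\<in>tiles G. (y, x) \<in> (loop_quiver G)\<^sup>* \<longrightarrow> y \<in> I)}"

section \<open>Ideal triangulations of bordered surfaces\<close>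

text \<open>
  A bordered surface with marked points together with an ideal triangulation is given by its
  triangles and their gluing.  The corners of each triangle are numbered 0, 1, 2 counterclockwise
  and its side \<open>i\<close> runs from corner \<open>i\<close> to corner \<open>i + 1\<close> (mod 3).  \<open>glue\<close> tells which side a
  side is glued to; the gluing reverses the direction of sides, so that the surface is oriented.
  Sides that are not glued are boundary segments, pairs of glued sides are the arcs of the
  triangulation, and the marked points are the classes of corners under the gluing.
  Two sides of the same triangle may be glued; if they are adjacent this is a self-folded
  triangle.
\<close>

type_synonym 't side = "'t \<times> nat"
type_synonym 't corner = "'t \<times> nat"

record 't triangulation =
  tris :: "'t set"
  glue :: "'t side \<Rightarrow> 't side option"

definition ideal_triangulation :: "'t triangulation \<Rightarrow> bool" where
  "ideal_triangulation T \<longleftrightarrow>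
     finite (tris T) \<and> tris T \<noteq> {} \<and>
     (\<forall>s s'. glue T s = Some s' \<longrightarrow>
        s \<in> tris T \<times> {0..<3} \<and> s' \<in> tris T \<times> {0..<3} \<and> s' \<noteq> s \<and> glue T s' = Some s) \<and>
     (\<forall>t\<in>tris T. \<forall>t'\<in>tris T. (t, t') \<in> {(fst s, fst s') | s s'. glue T s = Some s'}\<^sup>*)"

abbreviation opp_side :: "'t triangulation \<Rightarrow> 't side \<Rightarrow> 't side" where
  "opp_side T s \<equiv> the (glue T s)"

text \<open>The label of a tile edge that comes from the side \<open>s\<close>: the arc or boundary segment of \<open>s\<close>.\<close>

definition label :: "'t triangulation \<Rightarrow> 't side \<Rightarrow> 't side set" where
  "label T s = {s} \<union> set_option (glue T s)"

text \<open>
  Crossing the side \<open>i - 1\<close> next to corner \<open>i\<close> rotates counterclockwise about the vertex at that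
  corner, crossing the side \<open>i\<close> rotates clockwise.  The flag is true for counterclockwise.
\<close>

fun spoke :: "bool \<Rightarrow> 't corner \<Rightarrow> 't side" where
  "spoke ccw (t, i) = (if ccw then (t, (i + 2) mod 3) else (t, i))"

definition rotate_corner :: "'t triangulation \<Rightarrow> bool \<Rightarrow> 't corner \<Rightarrow> 't corner" where
  "rotate_corner T ccw C =
     (let (t', j) = opp_side T (spoke ccw C) in if ccw then (t', j) else (t', (j + 1) mod 3))"

definition same_vertex :: "'t triangulation \<Rightarrow> ('t corner \<times> 't corner) set" where
  "same_vertex T =
     {(C, rotate_corner T ccw C) | C ccw. glue T (spoke ccw C) \<noteq> None}\<^sup>*"

text \<open>The marked point at a corner is a puncture iff no side ending there is on the boundary.\<close>

definition at_puncture :: "'t triangulation \<Rightarrow> 't corner \<Rightarrow> bool" where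
  "at_puncture T C \<longleftrightarrow>
     (\<forall>C' ccw. (C, C') \<in> same_vertex T \<longrightarrow> glue T (spoke ccw C') \<noteq> None)"

text \<open>
  The marked point at a corner is enclosed by a self-folded triangle iff the two sides adjacent
  to the corner are glued to each other.
\<close>

definition enclosed_by_self_folded :: "'t triangulation \<Rightarrow> 't corner \<Rightarrow> bool" where
  "enclosed_by_self_folded T C \<longleftrightarrow> glue T (spoke True C) = Some (spoke False C)"

text \<open>
  The sides crossed when going once around the puncture at the corner \<open>C\<close>, starting and ending
  in the triangle of \<open>C\<close>.
\<close>

definition turn :: "'t triangulation \<Rightarrow> bool \<Rightarrow> 't corner \<Rightarrow> 't side list" where
  "turn T ccw C =
     map (\<lambda>i. spoke ccw ((rotate_corner T ccw ^^ i) C))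
         [0..<(LEAST n. 0 < n \<and> (rotate_corner T ccw ^^ n) C = C)]"

section \<open>Arcs\<close>

text \<open>
  A curve that connects two marked points and is in minimal position with respect to the
  triangulation is given, up to isotopy, by the list of sides through which it successively
  leaves the triangles it visits.  Minimal position means that the curve never leaves a triangle
  through the side by which it entered, and that it starts (ends) at the corner opposite to the
  first (last) side it crosses.  The list is nonempty iff the curve is not isotopic to an arc of
  the triangulation or to a boundary segment.
\<close>

definition crossing_list :: "'t triangulation \<Rightarrow> 't side list \<Rightarrow> bool" where
  "crossing_list T xs \<longleftrightarrow>
     xs \<noteq> [] \<and> (\<forall>s\<in>set xs. glue T s \<noteq> None) \<and>
     (\<forall>i. i + 1 < length xs \<longrightarrow>
        fst (xs ! (i + 1)) = fst (opp_side T (xs ! i)) \<and> xs ! (i + 1) \<noteq> opp_side T (xs ! i))"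

definition reverse_list :: "'t triangulation \<Rightarrow> 't side list \<Rightarrow> 't side list" where
  "reverse_list T xs = rev (map (opp_side T) xs)"

fun opposite_corner :: "'t side \<Rightarrow> 't corner" where
  "opposite_corner (t, i) = (t, (i + 2) mod 3)"

definition start_corner :: "'t side list \<Rightarrow> 't corner" where
  "start_corner xs = opposite_corner (hd xs)"

definition end_corner :: "'t triangulation \<Rightarrow> 't side list \<Rightarrow> 't corner" where
  "end_corner T xs = opposite_corner (opp_side T (last xs))"

text \<open>
  To say that a curve has no self-crossings it is drawn with straight segments in the triangles,
  each of which is identified with the triangle with the following three corners.  The parameter
  \<open>p i\<close> is the position of the \<open>i\<close>-th crossing point on the side \<open>xs ! i\<close>, hence \<open>1 - p i\<close> is its
  position on the side glued to it.
\<close>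

definition corner_point :: "nat \<Rightarrow> real \<times> real" where
  "corner_point i = (if i = 0 then (0, 0) else if i = 1 then (1, 0) else (0, 1))"

definition side_point :: "nat \<Rightarrow> real \<Rightarrow> real \<times> real" where
  "side_point i p = (1 - p) *\<^sub>R corner_point i + p *\<^sub>R corner_point ((i + 1) mod 3)"

text \<open>Segment number \<open>i\<close>, for \<open>0 \<le> i \<le> length xs\<close>, lies in the triangle \<open>segment_tri T xs i\<close>.\<close>

definition segment_tri :: "'t triangulation \<Rightarrow> 't side list \<Rightarrow> nat \<Rightarrow> 't" where
  "segment_tri T xs i = (if i = 0 then fst (hd xs) else fst (opp_side T (xs ! (i - 1))))"

definition segment :: "'t triangulation \<Rightarrow> 't side list \<Rightarrow> (nat \<Rightarrow> real) \<Rightarrow> nat \<Rightarrow> (real \<times> real) set" where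
  "segment T xs p i = closed_segment
     (if i = 0 then corner_point (snd (start_corner xs))
      else side_point (snd (opp_side T (xs ! (i - 1)))) (1 - p (i - 1)))
     (if i = length xs then corner_point (snd (end_corner T xs))
      else side_point (snd (xs ! i)) (p i))"

definition non_self_crossing :: "'t triangulation \<Rightarrow> 't side list \<Rightarrow> bool" where
  "non_self_crossing T xs \<longleftrightarrow>
     (\<exists>p. (\<forall>i<length xs. 0 < p i \<and> p i < 1) \<and>
          (\<forall>i\<le>length xs. \<forall>j\<le>length xs. i \<noteq> j \<and> segment_tri T xs i = segment_tri T xs j \<longrightarrow>
             segment T xs p i \<inter> segment T xs p j \<subseteq> corner_point ` {0, 1, 2}))"

text \<open>
  A curve cuts out a once-punctured monogon with puncture \<open>p\<close> iff it runs along an arc \<open>\<alpha>\<close> from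
  its base point to \<open>p\<close>, goes once around \<open>p\<close>, and returns along \<open>\<alpha>\<close>.  In the first case below
  \<open>\<alpha>\<close> crosses the triangulation; in the second case it belongs to the triangulation, and all ends
  of arcs at \<open>p\<close> except that of \<open>\<alpha>\<close> are crossed.
\<close>

definition cuts_out_once_punctured_monogon :: "'t triangulation \<Rightarrow> 't side list \<Rightarrow> bool" where
  "cuts_out_once_punctured_monogon T xs \<longleftrightarrow>
     (\<exists>C ccw. at_puncture T C \<and> (start_corner xs, C) \<notin> same_vertex T \<and>
        ((\<exists>ys. crossing_list T ys \<and> end_corner T ys = C \<and>
               xs = ys @ turn T ccw C @ reverse_list T ys) \<or>
         xs = butlast (turn T ccw C)))"

text \<open>\<open>nt1\<close> and \<open>nt2\<close> tell whether the arc is notched at its start and at its end.\<close>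

definition tagged_arc :: "'t triangulation \<Rightarrow> 't side list \<Rightarrow> bool \<Rightarrow> bool \<Rightarrow> bool" where
  "tagged_arc T xs nt1 nt2 \<longleftrightarrow>
     crossing_list T xs \<and> non_self_crossing T xs \<and>
     \<not> cuts_out_once_punctured_monogon T xs \<and>
     (nt1 \<longrightarrow> at_puncture T (start_corner xs)) \<and>
     (nt2 \<longrightarrow> at_puncture T (end_corner T xs)) \<and>
     ((start_corner xs, end_corner T xs) \<in> same_vertex T \<longrightarrow> nt1 = nt2)"

text \<open>
  Each notched end is replaced by a hook, which may turn either way round; \<open>o1\<close> and \<open>o2\<close> tell
  which (for the second hook: as seen when the arc is traversed backwards).
\<close>

definition hook :: "'t triangulation \<Rightarrow> bool \<Rightarrow> bool \<Rightarrow> 't side list \<Rightarrow> 't side list" where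
  "hook T nt ccw xs = (if nt then turn T ccw (start_corner xs) else [])"

definition hooked_arc :: "'t triangulation \<Rightarrow> bool \<Rightarrow> bool \<Rightarrow> bool \<Rightarrow> bool \<Rightarrow> 't side list \<Rightarrow> 't side list" where
  "hooked_arc T nt1 nt2 o1 o2 xs =
     hook T nt1 o1 xs @ xs @ reverse_list T (hook T nt2 o2 (reverse_list T xs))"

section \<open>Surface loop graphs\<close>

text \<open>
  The tile \<open>j\<close> of a curve consists of the triangles on both sides of the \<open>j\<close>-th crossed arc, which
  becomes its diagonal; the triangle that is visited first is put in the south-west.  It is drawn
  with the orientation of the surface if \<open>rel j = 1\<close> and with the opposite one otherwise.  Going
  counterclockwise, the sides of the south-west triangle are south, diagonal, west, and those of
  the north-east triangle are east, north, diagonal.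
\<close>

definition tile_side :: "'t triangulation \<Rightarrow> 't side list \<Rightarrow> nat \<Rightarrow> compass \<Rightarrow> 't side" where
  "tile_side T zs j s =
     (let (t, i) = zs ! (j - 1); (t', i') = opp_side T (t, i);
          a = (if rel j = 1 then 1 else 2); b = (if rel j = 1 then 2 else 1)
      in case s of
           West \<Rightarrow> (t, (i + a) mod 3) | South \<Rightarrow> (t, (i + b) mod 3)
         | East \<Rightarrow> (t', (i' + a) mod 3) | North \<Rightarrow> (t', (i' + b) mod 3))"

text \<open>
  Consecutive tiles are glued along the third side of the triangle between the two crossings,
  i.e. along the side that is not a diagonal in either tile.
\<close>

definition is_snake_graph_of :: "'t triangulation \<Rightarrow> 't side list \<Rightarrow> loop_graph \<Rightarrow> bool" where
  "is_snake_graph_of T zs G \<longleftrightarrow>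
     ntiles G = length zs \<and>
     (\<forall>j. 1 \<le> j \<and> j < ntiles G \<longrightarrow>
        (if right G j then tile_side T zs j East = tile_side T zs (j + 1) West
         else tile_side T zs j North = tile_side T zs (j + 1) South))"

definition surface_loop_graph :: "'t triangulation \<Rightarrow> loop_graph \<Rightarrow> bool" where
  "surface_loop_graph T G \<longleftrightarrow>
     (\<exists>xs nt1 nt2 o1 o2 zs.
        tagged_arc T xs nt1 nt2 \<and>
        (nt1 \<longrightarrow> \<not> enclosed_by_self_folded T (start_corner xs)) \<and>
        (nt2 \<longrightarrow> \<not> enclosed_by_self_folded T (end_corner T xs)) \<and>
        zs = hooked_arc T nt1 nt2 o1 o2 xs \<and>
        is_snake_graph_of T zs G \<and>
        k1 G = length (hook T nt1 o1 xs) + 1 \<and>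
        k2 G = length (hook T nt1 o1 xs) + length xs \<and>
        (has_loop1 G \<longrightarrow> cut1 G \<in> {South, West} \<and>
           label T (tile_side T zs 1 (cut1 G)) = label T (tile_side T zs (k1 G) (inner_cut1 G))) \<and>
        (has_loop2 G \<longrightarrow> cut2 G \<in> {North, East} \<and>
           label T (tile_side T zs (ntiles G) (cut2 G)) =
           label T (tile_side T zs (k2 G) (inner_cut2 G))))"

end

theory Submission
  imports Defs
begin

text \<open>
  Every edge of the snake graph joins two consecutive levels of the grid, and counting shows that a
  perfect matching contains exactly one edge between any two of them.  Hence it is encoded by the
  orientations of the diagonals, that is by its height \<open>I\<close>; that the edge between level \<open>l\<close> and level
  \<open>l + 1\<close> exists means precisely that \<open>I\<close> is closed under the arrow between \<open>l\<close> and \<open>l + 1\<close>.  The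
  matching comes from one of the loop graph iff for each loop it contains one of the copies of the cut
  edge, and this is closedness under the arrow of the loop.  Both a twist at \<open>j\<close> and a cover in the
  lattice then consist in adding \<open>j\<close> to the height.

  For this the cut edge of the outer tile has to be at the right position, the hooks have to be
  monotone paths in the quiver and the arrow next to a hook has to point against it.  This follows
  from the turns to the left and right of the hooked arc; the label of the cut edge determines its
  position because otherwise the arc would cross itself.
\<close>

section \<open>Perfect matchings of snake graphs\<close>

text \<open>The arrow of a loop closes a cycle in the underlying graph of the quiver. If the arrow
  next to a hook pointed along the hook, this cycle would be directed, its tiles could enter an
  ideal only together, and a cover would not be a single twist. The opposite direction keeps the
  quiver acyclic, so that a tile of minimal rank can always be added alone. The loop graph is a
  quotient that forgets which copy of a cut edge a matching of the snake graph used, and for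
  \<open>k1 = k2\<close> both loops may be glued at the same vertex. Hence the matchings are handled
  in the snake graph, and the quotient only enters through the edge classes contained in them. Since
  a hook makes at least two crossings, the copies of a cut edge are at least two levels apart, so no
  tile contains both.\<close>

text \<open>Sort the vertices by the sum of their coordinates.  Level 0 and level \<open>ntiles + 1\<close> consist of one
  vertex, and level \<open>j\<close> in between consists of the endpoints of the diagonal of tile \<open>j\<close>, the
  north-west one for the flag \<open>True\<close>.\<close>

definition vtx :: "loop_graph \<Rightarrow> nat \<Rightarrow> bool \<Rightarrow> vertex" where
  "vtx G j b = (if j = 0 then sw G 1 else if j = Suc (ntiles G) then ne G (ntiles G)
     else if b then nw G j else se G j)"

definition link :: "loop_graph \<Rightarrow> nat \<Rightarrow> bool \<Rightarrow> bool \<Rightarrow> edge" where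
  "link G l a b = {vtx G l a, vtx G (Suc l) b}"

text \<open>Three of the four pairs of ends of consecutive diagonals are joined by an edge; the
  exception is a pair of opposite corners of the rectangle formed by the two tiles.\<close>

definition allowed :: "loop_graph \<Rightarrow> nat \<Rightarrow> bool \<Rightarrow> bool \<Rightarrow> bool" where
  "allowed G l a b \<longleftrightarrow> (0 < l \<and> l < ntiles G \<longrightarrow> (if right G l then a \<longrightarrow> b else b \<longrightarrow> a))"

text \<open>Equivalently, the arrow between \<open>l\<close> and \<open>l + 1\<close> is \<open>l \<rightarrow> l + 1\<close>.\<close>

definition up :: "loop_graph \<Rightarrow> nat \<Rightarrow> bool" where
  "up G l \<longleftrightarrow> (odd l \<longleftrightarrow> right G l)"

text \<open>The orientation of the diagonal of tile \<open>j\<close> for a matching of height \<open>I\<close>.\<close>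

definition down :: "nat set \<Rightarrow> nat \<Rightarrow> bool" where
  "down I j \<longleftrightarrow> (odd j \<longleftrightarrow> j \<in> I)"

text \<open>The walk enters diagonal \<open>l\<close> at the end with flag \<open>down I l\<close>
  and leaves it at the other end, whence the negation.\<close>

definition snake_matching :: "loop_graph \<Rightarrow> nat set \<Rightarrow> edge set" where
  "snake_matching G I = (\<lambda>l. link G l (\<not> down I l) (down I (Suc l))) ` {..ntiles G}"

definition snake_closed :: "loop_graph \<Rightarrow> nat set \<Rightarrow> bool" where
  "snake_closed G I \<longleftrightarrow>
     (\<forall>l. 0 < l \<and> l < ntiles G \<longrightarrow> (if up G l then Suc l \<in> I \<longrightarrow> l \<in> I else l \<in> I \<longrightarrow> Suc l \<in> I))"

section \<open>Levels of vertices and the edges between them\<close>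

lemma sw_level: "fst (sw G (Suc j)) + snd (sw G (Suc j)) = j"
  by (induction j) (auto simp: Let_def split: prod.splits)

lemma vtx_level: "j \<le> Suc (ntiles G) \<Longrightarrow> 0 < ntiles G \<Longrightarrow> fst (vtx G j b) + snd (vtx G j b) = j"
  using sw_level[of G "j - 1"] sw_level[of G "ntiles G - 1"]
  by (auto simp: vtx_def nw_def se_def ne_def)

lemma vtx_eq_iff:
  assumes "0 < ntiles G" "j \<le> Suc (ntiles G)" "j' \<le> Suc (ntiles G)"
  shows "vtx G j a = vtx G j' b \<longleftrightarrow> j = j' \<and> (j = 0 \<or> j = Suc (ntiles G) \<or> a = b)"
proof
  assume eq: "vtx G j a = vtx G j' b"
  then have "j = j'" using vtx_level[of j G a] vtx_level[of j' G b] assms by simp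
  moreover have "a = b" if "j \<noteq> 0" "j \<noteq> Suc (ntiles G)"
    using eq that \<open>j = j'\<close> by (auto simp: vtx_def nw_def se_def split: if_splits)
  ultimately show "j = j' \<and> (j = 0 \<or> j = Suc (ntiles G) \<or> a = b)" by auto
qed (auto simp: vtx_def)

lemma vtx_link_iff:
  assumes "0 < ntiles G" "j \<le> Suc (ntiles G)" "l \<le> ntiles G"
  shows "vtx G j c \<in> link G l a b \<longleftrightarrow>
    j = l \<and> (l = 0 \<or> c = a) \<or> j = Suc l \<and> (l = ntiles G \<or> c = b)"
  using assms by (auto simp: link_def vtx_eq_iff)

lemma link_eq_iff:
  assumes "0 < ntiles G" "l \<le> ntiles G" "l' \<le> ntiles G"
  shows "link G l a b = link G l' a' b' \<longleftrightarrow> l = l' \<and> (l = 0 \<or> a = a') \<and> (l = ntiles G \<or> b = b')"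
  using assms by (auto simp: link_def doubleton_eq_iff vtx_eq_iff)

lemma corner_vtx:
  assumes "0 < j" "j \<le> ntiles G"
  shows "se G j = vtx G j False" "nw G j = vtx G j True"
    "sw G j = vtx G (j - 1) (\<not> right G (j - 1))" "ne G j = vtx G (Suc j) (right G j)"
proof -
  obtain i where i: "j = Suc i" using assms by (cases j) auto
  show "se G j = vtx G j False" "nw G j = vtx G j True"
    using assms by (auto simp: vtx_def)
  show "sw G j = vtx G (j - 1) (\<not> right G (j - 1))"
    using assms i by (cases i) (auto simp: vtx_def nw_def se_def Let_def split: prod.splits)
  show "ne G j = vtx G (Suc j) (right G j)"
    using assms i by (auto simp: vtx_def nw_def ne_def se_def Let_def split: prod.splits)
qed

lemma tile_edge_link:
  assumes "0 < j" "j \<le> ntiles G"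
  shows "tile_edge G j South = link G (j - 1) (\<not> right G (j - 1)) False"
    "tile_edge G j West = link G (j - 1) (\<not> right G (j - 1)) True"
    "tile_edge G j North = link G j True (right G j)"
    "tile_edge G j East = link G j False (right G j)"
  using assms by (auto simp: link_def corner_vtx)

lemma link_0: "link G 0 a b = link G 0 a' b" and link_last:
  "link G (ntiles G) a b = link G (ntiles G) a b'"
  by (auto simp: link_def vtx_def)

text \<open>A link between levels \<open>l\<close> and \<open>l + 1\<close> belongs to tile
  \<open>l + 1\<close> if it starts at the south-west vertex of that tile, and to tile
  \<open>l\<close> if it ends at the north-east vertex of that one. The forbidden pair of flags is
  the one for which neither holds.\<close>

lemma snake_edges_link:
  assumes "0 < ntiles G"
  shows "snake_edges G = {link G l a b | l a b. l \<le> ntiles G \<and> allowed G l a b}"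
proof
  show "snake_edges G \<subseteq> {link G l a b | l a b. l \<le> ntiles G \<and> allowed G l a b}"
  proof
    fix e assume "e \<in> snake_edges G"
    then obtain j s where j: "0 < j" "j \<le> ntiles G" and e: "e = tile_edge G j s"
      by (auto simp: snake_edges_def tiles_def Suc_le_eq)
    obtain l a b where "e = link G l a b" "l \<le> ntiles G" "allowed G l a b"
    proof (cases s)
      case North then show ?thesis using that[of j True "right G j"] j tile_edge_link[OF j] e
        by (auto simp: allowed_def)
    next
      case East then show ?thesis using that[of j False "right G j"] j tile_edge_link[OF j] e
        by (auto simp: allowed_def)
    next
      case South then show ?thesis
        using that[of "j - 1" "\<not> right G (j - 1)" False] j tile_edge_link[OF j] e
        by (auto simp: allowed_def)
    next
      case West then show ?thesis
        using that[of "j - 1" "\<not> right G (j - 1)" True] j tile_edge_link[OF j] e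
        by (auto simp: allowed_def)
    qed
    then show "e \<in> {link G l a b | l a b. l \<le> ntiles G \<and> allowed G l a b}" by blast
  qed
  show "{link G l a b | l a b. l \<le> ntiles G \<and> allowed G l a b} \<subseteq> snake_edges G"
  proof clarify
    fix l a b assume l: "l \<le> ntiles G" and al: "allowed G l a b"
    have lower: "link G l (\<not> right G l) b \<in> snake_edges G" if "l < ntiles G"
    proof -
      have "link G l (\<not> right G l) b = tile_edge G (Suc l) (if b then West else South)"
        using tile_edge_link[of "Suc l" G] that by simp
      then show ?thesis using that unfolding snake_edges_def tiles_def by force
    qed
    have upper: "link G l a (right G l) \<in> snake_edges G" if "0 < l"
    proof -
      have "link G l a (right G l) = tile_edge G l (if a then North else East)"
        using tile_edge_link[of l G] that l by simp
      then show ?thesis using that l unfolding snake_edges_def tiles_def by force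
    qed
    have "a = (\<not> right G l) \<or> b = right G l" if "0 < l" "l < ntiles G"
      using al that by (auto simp: allowed_def split: if_splits)
    then consider "l = 0" | "l = ntiles G" | "0 < l" "l < ntiles G" "a = (\<not> right G l)"
      | "0 < l" "l < ntiles G" "b = right G l"
      using l by linarith
    then show "link G l a b \<in> snake_edges G"
      using lower upper link_0[of G a b "\<not> right G 0"] link_last[of G a b "right G (ntiles G)"] assms
      by cases auto
  qed
qed

lemma snake_vertices_vtx:
  assumes "0 < ntiles G"
  shows "snake_vertices G = {vtx G j b | j b. j \<le> Suc (ntiles G)}"
proof
  show "snake_vertices G \<subseteq> {vtx G j b | j b. j \<le> Suc (ntiles G)}"
  proof
    fix v assume "v \<in> snake_vertices G"
    then obtain j where "0 < j" "j \<le> ntiles G" "v \<in> {sw G j, se G j, nw G j, ne G j}"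
      by (auto simp: snake_vertices_def tiles_def Suc_le_eq)
    moreover have "j - 1 \<le> Suc (ntiles G)" "j \<le> Suc (ntiles G)" "Suc j \<le> Suc (ntiles G)"
      using calculation by auto
    ultimately show "v \<in> {vtx G j b | j b. j \<le> Suc (ntiles G)}"
      using corner_vtx[of j G] by blast
  qed
  show "{vtx G j b | j b. j \<le> Suc (ntiles G)} \<subseteq> snake_vertices G"
    using assms unfolding snake_vertices_def tiles_def vtx_def by force
qed

lemma link_in_snake_matching:
  assumes "0 < ntiles G" "l \<le> ntiles G"
  shows "link G l a b \<in> snake_matching G I \<longleftrightarrow>
    (l = 0 \<or> a = (\<not> down I l)) \<and> (l = ntiles G \<or> b = down I (Suc l))"
  using assms by (auto simp: snake_matching_def link_eq_iff image_iff)

text \<open>The parities in \<open>down\<close> and \<open>up\<close> cancel: the forbidden pair of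
  flags means that the head of the arrow lies in \<open>I\<close> and its tail does not.\<close>

lemma allowed_down:
  "allowed G l (\<not> down I l) (down I (Suc l)) \<longleftrightarrow>
    (0 < l \<and> l < ntiles G \<longrightarrow> (if up G l then Suc l \<in> I \<longrightarrow> l \<in> I else l \<in> I \<longrightarrow> Suc l \<in> I))"
  by (auto simp: allowed_def down_def up_def)

lemma snake_matching_perfect:
  assumes "0 < ntiles G" "snake_closed G I"
  shows "snake_perfect_matching G (snake_matching G I)"
proof -
  have "snake_matching G I \<subseteq> snake_edges G"
  proof
    fix e assume "e \<in> snake_matching G I"
    then obtain l where l: "l \<le> ntiles G" "e = link G l (\<not> down I l) (down I (Suc l))"
      by (auto simp: snake_matching_def)
    then have "allowed G l (\<not> down I l) (down I (Suc l))"
      using assms(2) by (simp add: allowed_down snake_closed_def)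
    then show "e \<in> snake_edges G"
      unfolding snake_edges_link[OF assms(1)] l(2) using l(1) by blast
  qed
  moreover have "\<exists>!e. e \<in> snake_matching G I \<and> v \<in> e" if vG: "v \<in> snake_vertices G" for v
  proof -
    obtain j b where j: "j \<le> Suc (ntiles G)" and v: "v = vtx G j b"
      using vG unfolding snake_vertices_vtx[OF assms(1)] by blast
    define f where "f l = link G l (\<not> down I l) (down I (Suc l))" for l
    \<comment> \<open>The link at \<open>v\<close> goes up if \<open>v\<close> is the end at which
      the walk leaves its diagonal, and comes from below otherwise.\<close>
    define l where "l = (if j = 0 \<or> j \<noteq> Suc (ntiles G) \<and> b = (\<not> down I j) then j else j - 1)"
    have l: "l \<le> ntiles G" using j by (auto simp: l_def)
    have *: "v \<in> f l' \<longleftrightarrow> l' = l" if "l' \<le> ntiles G" for l'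
    proof -
      have "v \<in> f l' \<longleftrightarrow> j = l' \<and> (l' = 0 \<or> b = (\<not> down I j)) \<or> j = Suc l' \<and> (l' = ntiles G \<or> b
        = down I j)"
        unfolding v f_def vtx_link_iff[OF assms(1) j that] by blast
      also have "\<dots> \<longleftrightarrow> l' = l"
        using j that unfolding l_def by (cases "b = down I j") (simp; linarith)+
      finally show ?thesis .
    qed
    have "f l \<in> snake_matching G I" using l by (auto simp: snake_matching_def f_def)
    moreover have "e = f l" if "e \<in> snake_matching G I" "v \<in> e" for e
      using that * by (auto simp: snake_matching_def f_def[symmetric])
    ultimately show ?thesis using * l by blast
  qed
  ultimately show ?thesis by (auto simp: snake_perfect_matching_def)
qed

text \<open>The vertex of level 0 is unique, so by induction a perfect matching has exactly one edge
  between any two consecutive levels.\<close>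

lemma perfect_matching_is_snake_matching:
  assumes d: "0 < ntiles G" and Q: "snake_perfect_matching G Q"
  obtains I where "I \<subseteq> tiles G" "snake_closed G I" "Q = snake_matching G I"
proof -
  have sub: "e \<in> snake_edges G" if "e \<in> Q" for e
    using Q that by (auto simp: snake_perfect_matching_def)
  have ex1: "\<exists>!e. e \<in> Q \<and> vtx G j b \<in> e" if "j \<le> Suc (ntiles G)" for j b
  proof -
    have "vtx G j b \<in> snake_vertices G" using that unfolding snake_vertices_vtx[OF d] by blast
    then show ?thesis using Q unfolding snake_perfect_matching_def by simp
  qed
  have uniq: "e = e'" if "e \<in> Q" "e' \<in> Q" "vtx G j b \<in> e" "vtx G j b \<in> e'" "j \<le> Suc (ntiles G)"
    for e e' j b
    using ex1[OF that(5), of b] that by (auto simp: Ex1_def)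
  have cover: "\<exists>e\<in>Q. vtx G j b \<in> e" if "j \<le> Suc (ntiles G)" for j b
    using ex1[OF that, of b] by blast
  \<comment> \<open>Diagonal \<open>j\<close> points down iff the edge from below meets its
    north-west end; the parity turns this into membership.\<close>
  define I where "I = {j \<in> tiles G. odd j \<longleftrightarrow> (\<exists>a. link G (j - 1) a True \<in> Q)}"
  have down: "down I j \<longleftrightarrow> (\<exists>a. link G (j - 1) a True \<in> Q)" if "0 < j" "j \<le> ntiles G" for j
    using that by (auto simp: down_def I_def tiles_def)
  have level: "link G l (\<not> down I l) (down I (Suc l)) \<in> Q \<and>
      (\<forall>a b. link G l a b \<in> Q \<longrightarrow> link G l a b = link G l (\<not> down I l) (down I (Suc l)))"
    if "l \<le> ntiles G" for l
    using that
  proof (induction l)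
    case 0
    obtain e where e: "e \<in> Q" "vtx G 0 False \<in> e" using cover[of 0] by auto
    obtain l a b where "l \<le> ntiles G" "e = link G l a b"
      using sub[OF e(1)] snake_edges_link[OF d] by auto
    then have e': "e = link G 0 a b" using e(2) d by (auto simp: vtx_link_iff)
    have all: "link G 0 a' b' = e" if "link G 0 a' b' \<in> Q" for a' b'
      using uniq[of _ e 0 False] that e d by (simp add: vtx_link_iff)
    have "b = down I (Suc 0)"
    proof (cases b)
      case True then show ?thesis using down[of 1] e' e(1) d by auto
    next
      case False
      then have "link G 0 a' True \<notin> Q" for a'
        using all[of a' True] e' d by (auto simp: link_eq_iff)
      then show ?thesis using down[of 1] False d by auto
    qed
    then show ?case using e e' all link_0 by metis
  next
    case (Suc l)
    define b where "b = down I (Suc l)"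
    have IH: "link G l (\<not> down I l) b \<in> Q"
      "\<And>a' b'. link G l a' b' \<in> Q \<Longrightarrow> link G l a' b' = link G l (\<not> down I l) b"
      using Suc by (auto simp: b_def)
    \<comment> \<open>The edge from below covers the end with flag \<open>b\<close> and no other, so
      the edge at the opposite end has to go up.\<close>
    obtain e where e: "e \<in> Q" "vtx G (Suc l) (\<not> b) \<in> e" using cover[of "Suc l" "\<not> b"] Suc.prems by auto
    obtain l' a' b' where l': "l' \<le> ntiles G" "e = link G l' a' b'"
      using sub[OF e(1)] snake_edges_link[OF d] by auto
    have "l' \<noteq> l"
    proof
      assume "l' = l"
      then have "vtx G (Suc l) (\<not> b) \<in> link G l (\<not> down I l) b" using IH(2) e l' by auto
      then show False using Suc.prems d by (auto simp: vtx_link_iff)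
    qed
    then have e': "e = link G (Suc l) (\<not> b) b'"
      using e(2) l' Suc.prems d by (auto simp: vtx_link_iff)
    have all: "link G (Suc l) a'' b'' = e" if q: "link G (Suc l) a'' b'' \<in> Q" for a'' b''
    proof (cases "a'' = b")
      case True
      have "link G (Suc l) a'' b'' = link G l (\<not> down I l) b"
        using uniq[OF q IH(1), of "Suc l" b] True Suc.prems d by (simp add: vtx_link_iff)
      then show ?thesis using Suc.prems d by (auto simp: link_eq_iff)
    next
      case False
      then show ?thesis using uniq[OF q e(1), of "Suc l" "\<not> b"] e(2) Suc.prems d
        by (simp add: vtx_link_iff)
    qed
    have "link G (Suc l) (\<not> b) b' = link G (Suc l) (\<not> b) (down I (Suc (Suc l)))"
    proof (cases "Suc l = ntiles G")
      case True then show ?thesis using link_last by metis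
    next
      case False
      then have down': "down I (Suc (Suc l)) \<longleftrightarrow> (\<exists>a. link G (Suc l) a True \<in> Q)"
        using down[of "Suc (Suc l)"] Suc.prems by simp
      have "b' = down I (Suc (Suc l))"
      proof (cases b')
        case True
        then have "link G (Suc l) (\<not> b) True \<in> Q" using e(1) e' by simp
        then show ?thesis using down' True by blast
      next
        case b': False
        have "link G (Suc l) a True \<noteq> e" for a
          using b' e' False Suc.prems d by (simp add: link_eq_iff)
        then show ?thesis using down' all b' by blast
      qed
      then show ?thesis by simp
    qed
    then have "e = link G (Suc l) (\<not> down I (Suc l)) (down I (Suc (Suc l)))"
      unfolding e' b_def .
    then show ?case using all e(1) by metis
  qed
  have "Q = snake_matching G I"
  proof
    show "Q \<subseteq> snake_matching G I"
    proof
      fix e assume "e \<in> Q"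
      then obtain l a b where l: "l \<le> ntiles G" "e = link G l a b"
        using sub[OF \<open>e \<in> Q\<close>] unfolding snake_edges_link[OF d] by blast
      then show "e \<in> snake_matching G I"
        using level[OF l(1)] \<open>e \<in> Q\<close> unfolding snake_matching_def l(2) by blast
    qed
    show "snake_matching G I \<subseteq> Q" using level unfolding snake_matching_def by blast
  qed
  moreover have "snake_closed G I"
    unfolding snake_closed_def
  proof (intro allI impI)
    fix l assume l: "0 < l \<and> l < ntiles G"
    have "link G l (\<not> down I l) (down I (Suc l)) \<in> snake_edges G"
      using level[of l] sub l by (blast intro: less_imp_le)
    then have "allowed G l (\<not> down I l) (down I (Suc l))"
      using l d by (auto simp: snake_edges_link link_eq_iff)
    then show "if up G l then Suc l \<in> I \<longrightarrow> l \<in> I else l \<in> I \<longrightarrow> Suc l \<in> I"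
      using l by (simp add: allowed_down)
  qed
  moreover have "I \<subseteq> tiles G" by (auto simp: I_def)
  ultimately show thesis using that by blast
qed

section \<open>Good matchings of loop graphs\<close>

text \<open>This is all that the combinatorial part needs to know about the surface: hooks make at
  least two crossings, they are monotone in the quiver with the step next to them reversed, and the
  outer cut edges are at the right positions.\<close>

locale loop_shape =
  fixes G :: loop_graph
  assumes k1_pos: "1 \<le> k1 G" and k1_le_k2: "k1 G \<le> k2 G" and k2_le: "k2 G \<le> ntiles G"
    and loop1: "has_loop1 G \<Longrightarrow> 3 \<le> k1 G"
      "has_loop1 G \<Longrightarrow> cut1 G = (if up G (k1 G - 1) then South else West)"
      "\<lbrakk>has_loop1 G; 0 < l; Suc l < k1 G\<rbrakk> \<Longrightarrow> up G l \<longleftrightarrow> \<not> up G (k1 G - 1)"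
    and loop2: "has_loop2 G \<Longrightarrow> k2 G + 2 \<le> ntiles G"
      "has_loop2 G \<Longrightarrow> cut2 G = (if up G (k2 G) = odd (ntiles G) then East else North)"
      "\<lbrakk>has_loop2 G; k2 G < l; l < ntiles G\<rbrakk> \<Longrightarrow> up G l \<longleftrightarrow> \<not> up G (k2 G)"
begin

text \<open>\<open>b1\<close> and \<open>b2\<close> are the flags of the ends of the outer cut edges
  that lie on a diagonal. An inner cut edge joins corresponding ends of consecutive diagonals, so
  the single flag \<open>r1\<close> or \<open>r2\<close> describes both of its ends.\<close>

definition b1 where "b1 \<longleftrightarrow> \<not> up G (k1 G - 1)"
definition r1 where "r1 \<longleftrightarrow> \<not> right G (k1 G - 1)"
definition b2 where "b2 \<longleftrightarrow> up G (k2 G) \<noteq> odd (ntiles G)"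
definition r2 where "r2 \<longleftrightarrow> right G (k2 G)"

lemma d_pos: "0 < ntiles G" using k1_pos k1_le_k2 k2_le by simp

lemma cut_pairs_link:
  "cut_pairs G = (if has_loop1 G then {(link G 0 True b1, link G (k1 G - 1) r1 r1)} else {}) \<union>
    (if has_loop2 G then {(link G (ntiles G) b2 True, link G (k2 G) r2 r2)} else {})"
proof -
  have "(tile_edge G 1 (cut1 G), tile_edge G (k1 G) (inner_cut1 G))
      = (link G 0 True b1, link G (k1 G - 1) r1 r1)" if "has_loop1 G"
    using loop1(1,2)[OF that] d_pos k1_le_k2 k2_le
      tile_edge_link[of 1 G] tile_edge_link[of "k1 G" G] link_0[of G "\<not> right G 0" _ True]
    by (cases "right G (k1 G - 1)") (auto simp: b1_def r1_def inner_cut1_def)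
  moreover have "(tile_edge G (ntiles G) (cut2 G), tile_edge G (k2 G) (inner_cut2 G))
      = (link G (ntiles G) b2 True, link G (k2 G) r2 r2)" if "has_loop2 G"
    using loop2(1,2)[OF that] d_pos k1_pos k1_le_k2 k2_le
      tile_edge_link[of "ntiles G" G] tile_edge_link[of "k2 G" G] link_last[of G _
        "right G (ntiles G)" True]
    by (cases "right G (k2 G)") (auto simp: b2_def r2_def inner_cut2_def)
  ultimately show ?thesis unfolding cut_pairs_def by simp
qed

text \<open>The crosswise identification reverses levels: the lower end of the outer copy is glued
  to the upper end of the inner copy, and conversely.\<close>

lemma glued_vertices_vtx:
  "glued_vertices G =
    (if has_loop1 G then {(vtx G 0 True, vtx G (k1 G) r1), (vtx G 1 b1, vtx G (k1 G - 1) r1)} else {}) \<union>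
    (if has_loop2 G then {(vtx G (Suc (ntiles G)) True, vtx G (k2 G) r2),
       (vtx G (ntiles G) b2, vtx G (Suc (k2 G)) r2)} else {})"
proof -
  have "far_end G (k1 G) (inner_cut1 G) = vtx G (k1 G) r1" "far_end G 1 (cut1 G) = vtx G 1 b1"
    "sw G (k1 G) = vtx G (k1 G - 1) r1" if "has_loop1 G"
    using loop1(1,2)[OF that] d_pos k1_le_k2 k2_le corner_vtx[of 1 G] corner_vtx[of "k1 G" G]
    by (auto simp: far_end_def b1_def r1_def inner_cut1_def)
  moreover have "far_end G (k2 G) (inner_cut2 G) = vtx G (k2 G) r2"
    "far_end G (ntiles G) (cut2 G) = vtx G (ntiles G) b2"
    "ne G (k2 G) = vtx G (Suc (k2 G)) r2" if "has_loop2 G"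
    using loop2(1,2)[OF that] d_pos k1_pos k1_le_k2 k2_le corner_vtx[of "ntiles G" G] corner_vtx[of
      "k2 G" G]
    by (auto simp: far_end_def b2_def r2_def inner_cut2_def)
  moreover have "sw G 1 = vtx G 0 True" "ne G (ntiles G) = vtx G (Suc (ntiles G)) True"
    by (auto simp: vtx_def)
  ultimately show ?thesis unfolding glued_vertices_def by simp
qed

lemma levels: "has_loop1 G \<Longrightarrow> 3 \<le> k1 G \<and> k1 G \<le> k2 G \<and> k2 G \<le> ntiles G"
  "has_loop2 G \<Longrightarrow> 1 \<le> k1 G \<and> k1 G \<le> k2 G \<and> k2 G + 2 \<le> ntiles G"
  using k1_pos k1_le_k2 k2_le loop1(1) loop2(1) by auto

lemma cut_pairs_unique:
  assumes "(c, c') \<in> cut_pairs G" "(f, f') \<in> cut_pairs G"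
  shows "c = f \<longleftrightarrow> c' = f'" "c \<noteq> f'"
  using assms levels d_pos by (auto simp: cut_pairs_link link_eq_iff split: if_splits)

text \<open>By \<open>3 \<le> k1 G\<close> and \<open>k2 G + 2 \<le> ntiles G\<close>, the outer
  vertices of the loops present lie on levels that no inner vertex reaches. Two outer vertices may
  share an inner one if \<open>k1 = k2\<close>.\<close>

lemma glued_unique:
  assumes "(u, i) \<in> glued_vertices G"
  shows "(u, j) \<in> glued_vertices G \<longleftrightarrow> j = i" "(i, j) \<notin> glued_vertices G"
  using assms levels d_pos by (auto simp: glued_vertices_vtx vtx_eq_iff split: if_splits)

lemma glued_cut:
  assumes "(u, i) \<in> glued_vertices G"
  obtains c c' where "(c, c') \<in> cut_pairs G" "u \<in> c" "i \<in> c'"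
  using assms levels d_pos k1_pos
  by (auto simp: glued_vertices_vtx cut_pairs_link link_def split: if_splits)

lemma cut_glued:
  assumes "(c, c') \<in> cut_pairs G"
  shows "v \<in> c \<Longrightarrow> \<exists>i\<in>c'. (v, i) \<in> glued_vertices G"
    "v \<in> c' \<Longrightarrow> \<exists>u\<in>c. (u, v) \<in> glued_vertices G"
    "\<lbrakk>v \<in> c; w \<in> c; (v, i) \<in> glued_vertices G; (w, i) \<in> glued_vertices G\<rbrakk> \<Longrightarrow> v = w"
  subgoal using assms levels d_pos k1_pos
    by (auto simp: glued_vertices_vtx cut_pairs_link link_def vtx_def split: if_splits)
  subgoal using assms levels d_pos k1_pos
    by (auto simp: glued_vertices_vtx cut_pairs_link link_def split: if_splits)
  subgoal using assms levels d_pos k1_pos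
    by (auto simp: glued_vertices_vtx cut_pairs_link link_def vtx_eq_iff split: if_splits)
  done

text \<open>Again by levels. If the outer copy is missing from a matching, the edges that cover its
  ends are therefore ordinary edges, which survive in the quotient.\<close>

lemma outer_cut_disjoint:
  assumes "(c, c') \<in> cut_pairs G" "v \<in> c" "v \<in> e" "e \<in> Field (cut_pairs G)"
  shows "e = c"
  using assms levels d_pos k1_pos
  by (auto simp: cut_pairs_link link_def vtx_eq_iff Field_def split: if_splits)

lemma edge_class_cut:
  assumes "(c, c') \<in> cut_pairs G"
  shows "edge_class G c = {c, c'}" "edge_class G c' = {c, c'}"
proof -
  let ?R = "cut_pairs G \<union> (cut_pairs G)\<inverse>"
  have "?R `` {c, c'} \<subseteq> {c, c'}"
  proof
    fix x assume "x \<in> ?R `` {c, c'}"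
    then consider "(c, x) \<in> cut_pairs G" | "(x, c) \<in> cut_pairs G"
      | "(c', x) \<in> cut_pairs G" | "(x, c') \<in> cut_pairs G" by blast
    then show "x \<in> {c, c'}"
      by cases (use cut_pairs_unique[OF assms] cut_pairs_unique(2)[OF _ assms] in blast)+
  qed
  then have "edge_rel G `` {c, c'} = {c, c'}"
    unfolding edge_rel_def by (rule Image_closed_trancl)
  moreover have "(c, c') \<in> edge_rel G" "(c', c) \<in> edge_rel G" "(c, c) \<in> edge_rel G"
    "(c', c') \<in> edge_rel G"
    using assms by (auto simp: edge_rel_def)
  ultimately show "edge_class G c = {c, c'}" "edge_class G c' = {c, c'}"
    unfolding edge_class_def by blast+
qed

lemma edge_class_not_cut:
  assumes "e \<notin> Field (cut_pairs G)"
  shows "edge_class G e = {e}"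
proof -
  have "(cut_pairs G \<union> (cut_pairs G)\<inverse>) `` {e} \<subseteq> {e}" using assms by (auto simp: Field_def)
  then show ?thesis unfolding edge_class_def edge_rel_def by (rule Image_closed_trancl)
qed

lemma edge_class_self: "e \<in> edge_class G e"
  by (auto simp: edge_class_def edge_rel_def)

lemma edge_class_eq: "f \<in> edge_class G e \<Longrightarrow> edge_class G f = edge_class G e"
proof (cases "e \<in> Field (cut_pairs G)")
  case True
  assume f: "f \<in> edge_class G e"
  obtain c c' where "(c, c') \<in> cut_pairs G" "e = c \<or> e = c'" using True by (auto simp: Field_def)
  then show ?thesis using f edge_class_cut[of c c'] by auto
qed (auto simp: edge_class_not_cut)

lemma loop_edges_iff: "F \<in> loop_edges G \<longleftrightarrow> (\<exists>e\<in>snake_edges G. F = edge_class G e)"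
  by (auto simp: loop_edges_def quotient_def edge_class_def)

text \<open>The first components of \<open>glued_vertices\<close> are never second components, and each is glued to
  a unique vertex, which therefore serves as the representative of its class.\<close>

definition rep :: "vertex \<Rightarrow> vertex" where
  "rep v = (if \<exists>i. (v, i) \<in> glued_vertices G then THE i. (v, i) \<in> glued_vertices G else v)"

lemma rep_glued: "(u, i) \<in> glued_vertices G \<Longrightarrow> rep u = i"
  unfolding rep_def using glued_unique(1)[of u i] by auto

lemma rep_eq_iff: "rep v = i \<longleftrightarrow> (v, i) \<in> glued_vertices G \<or> v = i \<and> (\<forall>j. (v, j) \<notin> glued_vertices G)"
  using rep_glued[of v] unfolding rep_def by metis

lemma rep_rep: "rep (rep v) = rep v"
  using rep_eq_iff[of v "rep v"] rep_eq_iff[of "rep v" "rep v"] glued_unique(2)[of v "rep v"] by auto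

lemma vertex_rel_iff: "(v, w) \<in> vertex_rel G \<longleftrightarrow> rep v = rep w"
proof
  assume "(v, w) \<in> vertex_rel G"
  then show "rep v = rep w"
    unfolding vertex_rel_def
  proof (induction rule: rtrancl_induct)
    case (step y z)
    moreover have "rep a = rep b" if "(a, b) \<in> glued_vertices G" for a b
      using rep_glued[OF that] glued_unique(2)[OF that] rep_eq_iff[of b b] by auto
    ultimately show ?case by (metis Un_iff converse_iff)
  qed simp
next
  assume eq: "rep v = rep w"
  have "(v, rep v) \<in> vertex_rel G" "(rep v, v) \<in> vertex_rel G" for v
    using rep_eq_iff[of v "rep v"] unfolding vertex_rel_def by auto
  then show "(v, w) \<in> vertex_rel G"
    using eq unfolding vertex_rel_def by (metis rtrancl_trans)
qed

end

text \<open>This undoes the cutting: a cut edge is kept if both copies are present, and a single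
  copy is discarded.\<close>

definition loop_restriction :: "loop_graph \<Rightarrow> edge set \<Rightarrow> edge set set" where
  "loop_restriction G Q = {F \<in> loop_edges G. F \<subseteq> Q}"

definition hits_cuts :: "loop_graph \<Rightarrow> edge set \<Rightarrow> bool" where
  "hits_cuts G Q \<longleftrightarrow> (\<forall>(c, c')\<in>cut_pairs G. c \<in> Q \<or> c' \<in> Q)"

context loop_shape begin

lemma edge_class_in_restriction:
  assumes "Q \<subseteq> snake_edges G"
  shows "edge_class G e \<in> loop_restriction G Q \<longleftrightarrow> edge_class G e \<subseteq> Q"
  using assms edge_class_self by (auto simp: loop_restriction_def loop_edges_iff)

text \<open>A class of two copies lies in the restriction iff \<open>Q\<close> contains both, which
  is the first branch of \<open>extends_to\<close>; \<open>hits_cuts\<close> excludes that both are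
  missing. So \<open>P\<close> becomes a function of \<open>Q\<close>.\<close>

lemma extends_to_iff:
  assumes "P \<subseteq> loop_edges G"
  shows "extends_to G P Q \<longleftrightarrow>
    snake_perfect_matching G Q \<and> hits_cuts G Q \<and> P = loop_restriction G Q"
proof (cases "snake_perfect_matching G Q")
  case True
  then have sub: "Q \<subseteq> snake_edges G" by (simp add: snake_perfect_matching_def)
  show ?thesis
  proof
    assume ext: "extends_to G P Q"
    have cut: "hits_cuts G Q" "(c, c') \<in> cut_pairs G \<Longrightarrow> edge_class G c \<in> P \<longleftrightarrow> c \<in> Q \<and> c' \<in> Q" for c c'
      using ext by (auto simp: extends_to_def hits_cuts_def split: if_splits)
    have "edge_class G e \<in> P \<longleftrightarrow> edge_class G e \<subseteq> Q" if "e \<in> snake_edges G" for e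
    proof (cases "e \<in> Field (cut_pairs G)")
      case True
      then obtain c c' where c: "(c, c') \<in> cut_pairs G" "e = c \<or> e = c'" by (auto simp: Field_def)
      then show ?thesis using cut(2)[OF c(1)] edge_class_cut[OF c(1)] by auto
    next
      case False
      then show ?thesis using that ext by (auto simp: extends_to_def edge_class_not_cut)
    qed
    then have "P = loop_restriction G Q"
      using assms unfolding loop_restriction_def by (auto simp: loop_edges_iff subset_iff)
    then show "snake_perfect_matching G Q \<and> hits_cuts G Q \<and> P = loop_restriction G Q"
      using True cut(1) by simp
  next
    assume r: "snake_perfect_matching G Q \<and> hits_cuts G Q \<and> P = loop_restriction G Q"
    have "if edge_class G c \<in> P then c \<in> Q \<and> c' \<in> Q else (c \<in> Q) \<noteq> (c' \<in> Q)"
      if "(c, c') \<in> cut_pairs G" for c c'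
    proof -
      have "edge_class G c \<in> P \<longleftrightarrow> c \<in> Q \<and> c' \<in> Q"
        using r edge_class_in_restriction[OF sub, of c] edge_class_cut[OF that] by simp
      moreover have "c \<in> Q \<or> c' \<in> Q" using r that by (auto simp: hits_cuts_def)
      ultimately show ?thesis by auto
    qed
    moreover have "e \<in> Q \<longleftrightarrow> edge_class G e \<in> P" if "e \<in> snake_edges G - Field (cut_pairs G)" for e
      using r that edge_class_in_restriction[OF sub, of e] by (auto simp: edge_class_not_cut)
    ultimately show "extends_to G P Q" using True unfolding extends_to_def by blast
  qed
qed (simp add: extends_to_def)

text \<open>A vertex class consists of a vertex \<open>i\<close> and the outer vertices glued to it.
  If the edge \<open>g\<close> at \<open>i\<close> is no copy of a cut edge, it survives, while the
  outer vertices are covered by single outer copies, which are discarded. If \<open>g\<close> is an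
  inner copy whose partner is present, the two merge into one edge. If the partner is missing,
  \<open>g\<close> is discarded and the edge at the glued end of the missing copy takes
  over.\<close>

lemma loop_restriction_perfect:
  assumes Q: "snake_perfect_matching G Q" and hits: "hits_cuts G Q"
  shows "loop_perfect_matching G (loop_restriction G Q)"
proof -
  let ?P = "loop_restriction G Q"
  have sub: "Q \<subseteq> snake_edges G" using Q by (simp add: snake_perfect_matching_def)
  have inP: "edge_class G e \<in> ?P \<longleftrightarrow> edge_class G e \<subseteq> Q" for e
    by (rule edge_class_in_restriction[OF sub])
  have hit: "c \<in> Q \<or> c' \<in> Q" if "(c, c') \<in> cut_pairs G" for c c'
    using that hits by (auto simp: hits_cuts_def)
  have snake_v: "v \<in> snake_vertices G" if "(v, w) \<in> glued_vertices G \<or> (w, v) \<in> glued_vertices G"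
    for v w
  proof -
    have "\<exists>j b. v = vtx G j b \<and> j \<le> Suc (ntiles G)"
      using that levels by (auto simp: glued_vertices_vtx split: if_splits)
    then show ?thesis unfolding snake_vertices_vtx[OF d_pos] by blast
  qed
  have uniq: "e = f" if "e \<in> Q" "f \<in> Q" "v \<in> e" "v \<in> f" "v \<in> snake_vertices G" for e f v
    using Q that by (auto simp: snake_perfect_matching_def)
  have cover: "\<exists>e\<in>Q. v \<in> e" if "v \<in> snake_vertices G" for v
    using Q that by (auto simp: snake_perfect_matching_def)
  have "\<exists>!F. F \<in> ?P \<and> incident X F" if X: "X \<in> loop_vertices G" for X
  proof -
    obtain v where v: "v \<in> snake_vertices G" "X = vertex_rel G `` {v}"
      using X by (auto simp: loop_vertices_def quotient_def)
    define i where "i = rep v"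
    have X_iff: "w \<in> X \<longleftrightarrow> w = i \<or> (w, i) \<in> glued_vertices G" for w
      using v(2) rep_rep[of v] rep_eq_iff[of w i] rep_eq_iff[of i i] glued_unique(2)[of w i]
      by (auto simp: i_def vertex_rel_iff)
    have not_outer: "(i, j) \<notin> glued_vertices G" for j
      using rep_rep[of v] rep_eq_iff[of i i] glued_unique(2)[of i i] unfolding i_def by metis
    have i: "i \<in> snake_vertices G"
      using v(1) rep_eq_iff[of v i] snake_v[of i v] by (auto simp: i_def)
    obtain g where g: "g \<in> Q" "i \<in> g" using cover[OF i] by blast
    text \<open>It suffices to find \<open>f\<close> and to show that it is the only edge of \<open>Q\<close> at \<open>X\<close> that is not
      removed together with a missing copy.\<close>
    have criterion: ?thesis
      if f: "edge_class G f \<subseteq> Q" "w \<in> X" "w \<in> f"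
        and only: "\<And>e u. \<lbrakk>e \<in> Q; edge_class G e \<subseteq> Q; u \<in> X; u \<in> e\<rbrakk> \<Longrightarrow> edge_class G e = edge_class G f"
      for f w
    proof (rule ex1I[of _ "edge_class G f"])
      show "edge_class G f \<in> ?P \<and> incident X (edge_class G f)"
        using f edge_class_self inP by (auto simp: incident_def)
    next
      fix F assume F: "F \<in> ?P \<and> incident X F"
      then obtain e u where e: "e \<in> F" "u \<in> X" "u \<in> e" by (auto simp: incident_def)
      obtain h where "F = edge_class G h" using F by (auto simp: loop_restriction_def loop_edges_iff)
      then have F': "F = edge_class G e" using edge_class_eq[of e h] e(1) by simp
      have "F \<subseteq> Q" using F by (simp add: loop_restriction_def)
      then show "F = edge_class G f" using only[of e u] e F' by auto
    qed
    \<comment> \<open>An outer vertex whose inner copy is missing is covered by the outer copy, as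
      one of them is present, and this single copy is discarded.\<close>
    have dead: False
      if "(c, c') \<in> cut_pairs G" "c' \<notin> Q" "u \<in> c" "e \<in> Q" "u \<in> e" "edge_class G e \<subseteq> Q"
        "(u, i) \<in> glued_vertices G" for c c' e u
      using that hit[OF that(1)] uniq[of e c u] edge_class_cut[OF that(1)] snake_v[of u i] by auto
    show ?thesis
    proof (cases "g \<in> Field (cut_pairs G)")
      case False
      show ?thesis
      proof (rule criterion[of g i])
        show "edge_class G g \<subseteq> Q" using False g by (simp add: edge_class_not_cut)
        show "i \<in> X" "i \<in> g" using X_iff g by auto
        fix e u assume e: "e \<in> Q" "edge_class G e \<subseteq> Q" "u \<in> X" "u \<in> e"
        show "edge_class G e = edge_class G g"
        proof (cases "u = i")
          case True then show ?thesis using uniq[OF e(1) g(1), of i] e g i by simp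
        next
          case False': False
          then have u: "(u, i) \<in> glued_vertices G" using e(3) X_iff by auto
          obtain c c' where c: "(c, c') \<in> cut_pairs G" "u \<in> c" "i \<in> c'" using glued_cut[OF u] .
          have "c' \<notin> Q" using uniq[of c' g i] c g i False by (auto simp: Field_def)
          then show ?thesis using dead[OF c(1) _ c(2) e(1,4,2) u] by simp
        qed
      qed
    next
      case True
      \<comment> \<open>\<open>g\<close> cannot be an outer copy, because \<open>i\<close> is not
        glued to a further vertex.\<close>
      then obtain c where c: "(c, g) \<in> cut_pairs G"
        using cut_glued(1)[of g _ i] not_outer g(2) by (auto simp: Field_def)
      obtain w where w: "w \<in> c" "(w, i) \<in> glued_vertices G" using cut_glued(2)[OF c g(2)] by blast
      have wX: "w \<in> X" using X_iff w by simp
      have outer: "u \<in> c \<and> u = w"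
        if e: "e \<in> Q" "edge_class G e \<subseteq> Q" "u \<in> X" "u \<in> e" "u \<noteq> i" for e u
      proof -
        have u: "(u, i) \<in> glued_vertices G" using e X_iff by auto
        obtain h h' where h: "(h, h') \<in> cut_pairs G" "u \<in> h" "i \<in> h'" using glued_cut[OF u] .
        have "h' \<in> Q" using dead[OF h(1) _ h(2) e(1,4,2) u] by blast
        then have "h' = g" using uniq[of h' g i] g h(3) i by simp
        then have "h = c" using cut_pairs_unique(1)[OF h(1) c] by simp
        then show ?thesis using h(2) cut_glued(3)[OF c _ w(1) u w(2)] by simp
      qed
      show ?thesis
      proof (cases "c \<in> Q")
        case cQ: True
        show ?thesis
        proof (rule criterion[of g i])
          show "edge_class G g \<subseteq> Q" using edge_class_cut[OF c] cQ g by simp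
          show "i \<in> X" "i \<in> g" using X_iff g by auto
          fix e u assume e: "e \<in> Q" "edge_class G e \<subseteq> Q" "u \<in> X" "u \<in> e"
          show "edge_class G e = edge_class G g"
          proof (cases "u = i")
            case True then show ?thesis using uniq[OF e(1) g(1), of i] e g i by simp
          next
            case False
            then have "u \<in> c" "(u, i) \<in> glued_vertices G" using outer e X_iff by auto
            then have "e = c" using uniq[OF e(1) cQ e(4)] snake_v[of u i] by blast
            then show ?thesis using edge_class_cut[OF c] by simp
          qed
        qed
      next
        case cQ: False
        \<comment> \<open>The inner copy \<open>g\<close> is discarded, so \<open>f\<close> has to
          cover the class.\<close>
        obtain f where f: "f \<in> Q" "w \<in> f" using cover[of w] snake_v w by blast
        have "f \<notin> Field (cut_pairs G)" using outer_cut_disjoint[OF c w(1) f(2)] cQ f by blast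
        then have cf: "edge_class G f = {f}" by (rule edge_class_not_cut)
        show ?thesis
        proof (rule criterion[of f w])
          show "edge_class G f \<subseteq> Q" using cf f by simp
          show "w \<in> X" "w \<in> f" using wX f by auto
          fix e u assume e: "e \<in> Q" "edge_class G e \<subseteq> Q" "u \<in> X" "u \<in> e"
          have "u \<noteq> i"
          proof
            assume "u = i"
            then have "e = g" using uniq[OF e(1) g(1), of i] e g i by simp
            then show False using e(2) cQ edge_class_cut[OF c] by simp
          qed
          then have "u = w" using outer e by blast
          then show "edge_class G e = edge_class G f"
            using uniq[OF e(1) f(1), of w] e f snake_v[of w i] w by simp
        qed
      qed
    qed
  qed
  then show ?thesis by (auto simp: loop_perfect_matching_def loop_restriction_def)
qed

section \<open>Order ideals as sets closed under single arrows\<close>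

definition loop_closed :: "nat set \<Rightarrow> bool" where
  "loop_closed I \<longleftrightarrow>
     (has_loop1 G \<longrightarrow> (if up G (k1 G - 1) then 1 \<in> I \<longrightarrow> k1 G \<in> I else k1 G \<in> I \<longrightarrow> 1 \<in> I)) \<and>
     (has_loop2 G \<longrightarrow> (if up G (k2 G) then k2 G \<in> I \<longrightarrow> ntiles G \<in> I else ntiles G \<in> I \<longrightarrow> k2 G \<in> I))"

lemma snake_quiver_iff:
  "(y, x) \<in> snake_quiver G \<longleftrightarrow>
    (\<exists>l. 0 < l \<and> l < ntiles G \<and> (y, x) = (if up G l then (l, Suc l) else (Suc l, l)))"
proof
  assume "(y, x) \<in> snake_quiver G"
  then consider i where "y = i" "x = Suc i" "i \<in> tiles G" "Suc i \<in> tiles G" "up G i"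
    | i where "y = i" "x = i - 1" "i \<in> tiles G" "i - 1 \<in> tiles G"
      "odd i \<and> right G (i - 1) \<or> even i \<and> \<not> right G (i - 1)"
    by (auto simp: snake_quiver_def up_def)
  then show "\<exists>l. 0 < l \<and> l < ntiles G \<and> (y, x) = (if up G l then (l, Suc l) else (Suc l, l))"
  proof cases
    case (2 i)
    then obtain l where "i = Suc l" "0 < l" by (cases i) (auto simp: tiles_def)
    then show ?thesis using 2 by (intro exI[of _ l]) (auto simp: tiles_def up_def)
  next
    case (1 i)
    then show ?thesis by (intro exI[of _ i]) (auto simp: tiles_def)
  qed
next
  assume "\<exists>l. 0 < l \<and> l < ntiles G \<and> (y, x) = (if up G l then (l, Suc l) else (Suc l, l))"
  then show "(y, x) \<in> snake_quiver G"
    by (auto simp: snake_quiver_def tiles_def up_def split: if_splits)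
qed

text \<open>The position of the inner cut edge is determined by the gluing to the neighbouring tile,
  so together with the parity it amounts to \<open>up\<close> of that step. The arrow of this step
  and that of the loop compose to a path through the inner tile.\<close>

lemma loop_quiver_iff:
  "(y, x) \<in> loop_quiver G \<longleftrightarrow> (y, x) \<in> snake_quiver G
    \<or> has_loop1 G \<and> (y, x) = (if up G (k1 G - 1) then (k1 G, 1) else (1, k1 G))
    \<or> has_loop2 G \<and> (y, x) = (if up G (k2 G) then (ntiles G, k2 G) else (k2 G, ntiles G))"
proof -
  have "(odd (k1 G) \<and> inner_cut1 G = South \<or> even (k1 G) \<and> inner_cut1 G = West) \<longleftrightarrow> \<not> up G (k1 G - 1)"
    using k1_pos by (auto simp: inner_cut1_def up_def)
  moreover have "(odd (k2 G) \<and> inner_cut2 G = North \<or> even (k2 G) \<and> inner_cut2 G = East) \<longleftrightarrow> up G (k2 G)"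
    by (auto simp: inner_cut2_def up_def)
  ultimately show ?thesis unfolding loop_quiver_def by auto
qed

lemma loop_quiver_tiles: "(y, x) \<in> loop_quiver G \<Longrightarrow> y \<in> tiles G \<and> x \<in> tiles G"
  using levels d_pos by (auto simp: loop_quiver_iff snake_quiver_iff tiles_def split: if_splits)

lemma order_ideals_arrows:
  "order_ideals G = {I. I \<subseteq> tiles G \<and> (\<forall>(y, x)\<in>loop_quiver G. x \<in> I \<longrightarrow> y \<in> I)}"
proof -
  have "(\<forall>x\<in>I. \<forall>y\<in>tiles G. (y, x) \<in> (loop_quiver G)\<^sup>* \<longrightarrow> y \<in> I)
      \<longleftrightarrow> (\<forall>(y, x)\<in>loop_quiver G. x \<in> I \<longrightarrow> y \<in> I)" (is "?L \<longleftrightarrow> ?R") for I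
  proof
    assume ?L then show ?R using loop_quiver_tiles by blast
  next
    assume R: ?R
    have "y \<in> I" if "(y, x) \<in> (loop_quiver G)\<^sup>*" "x \<in> I" for x y
      using that R by (induction rule: converse_rtrancl_induct) auto
    then show ?L by blast
  qed
  then show ?thesis unfolding order_ideals_def by simp
qed

lemma order_ideals_iff: "I \<in> order_ideals G \<longleftrightarrow> I \<subseteq> tiles G \<and> snake_closed G I \<and> loop_closed I"
proof -
  have "(\<forall>(y, x)\<in>snake_quiver G. x \<in> I \<longrightarrow> y \<in> I) \<longleftrightarrow> snake_closed G I"
  proof
    assume R: "\<forall>(y, x)\<in>snake_quiver G. x \<in> I \<longrightarrow> y \<in> I"
    show "snake_closed G I"
      unfolding snake_closed_def
    proof (intro allI impI)
      fix l assume "0 < l \<and> l < ntiles G"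
      then have "(if up G l then (l, Suc l) else (Suc l, l)) \<in> snake_quiver G"
        using snake_quiver_iff by (metis surj_pair)
      then show "if up G l then Suc l \<in> I \<longrightarrow> l \<in> I else l \<in> I \<longrightarrow> Suc l \<in> I"
        using R by (auto split: if_splits)
    qed
  qed (auto simp: snake_quiver_iff snake_closed_def split: if_splits)
  moreover have "(\<forall>(y, x)\<in>loop_quiver G. x \<in> I \<longrightarrow> y \<in> I) \<longleftrightarrow>
      (\<forall>(y, x)\<in>snake_quiver G. x \<in> I \<longrightarrow> y \<in> I) \<and> loop_closed I"
    unfolding loop_closed_def by (simp add: loop_quiver_iff Ball_def) blast
  ultimately show ?thesis by (auto simp: order_ideals_arrows)
qed

text \<open>An inner copy prescribes two adjacent diagonals, but closedness at the step between them
  makes the condition on the inner tile imply the other one. So each copy is a condition on one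
  tile, and both copies are missing exactly if the arrow of the loop is violated.\<close>

lemma cut_edges_in_matching:
  assumes "snake_closed G I"
  shows "has_loop1 G \<Longrightarrow> link G 0 True b1 \<in> snake_matching G I \<longleftrightarrow> (1 \<in> I \<longleftrightarrow> \<not> up G (k1 G - 1))"
    "has_loop1 G \<Longrightarrow> link G (k1 G - 1) r1 r1 \<in> snake_matching G I \<longleftrightarrow> (k1 G \<in> I \<longleftrightarrow> up G (k1 G - 1))"
    "has_loop2 G \<Longrightarrow> link G (ntiles G) b2 True \<in> snake_matching G I \<longleftrightarrow> (ntiles G \<in> I \<longleftrightarrow> up G (k2 G))"
    "has_loop2 G \<Longrightarrow> link G (k2 G) r2 r2 \<in> snake_matching G I \<longleftrightarrow> (k2 G \<in> I \<longleftrightarrow> \<not> up G (k2 G))"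
proof -
  have closed: "if up G l then Suc l \<in> I \<longrightarrow> l \<in> I else l \<in> I \<longrightarrow> Suc l \<in> I"
    if "0 < l" "l < ntiles G" for l using assms that by (simp add: snake_closed_def)
  show "has_loop1 G \<Longrightarrow> link G 0 True b1 \<in> snake_matching G I \<longleftrightarrow> (1 \<in> I \<longleftrightarrow> \<not> up G (k1 G - 1))"
    using d_pos by (auto simp: link_in_snake_matching b1_def down_def)
  show "link G (k1 G - 1) r1 r1 \<in> snake_matching G I \<longleftrightarrow> (k1 G \<in> I \<longleftrightarrow> up G (k1 G - 1))" if "has_loop1 G"
    using levels(1)[OF that] closed[of "k1 G - 1"] d_pos less_le_trans[of "k1 G - 1" "k1 G" "ntiles G"]
    by (auto simp: link_in_snake_matching r1_def down_def up_def split: if_splits)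
  show "has_loop2 G \<Longrightarrow> link G (ntiles G) b2 True \<in> snake_matching G I \<longleftrightarrow> (ntiles G \<in> I \<longleftrightarrow> up G (k2 G))"
    using d_pos by (auto simp: link_in_snake_matching b2_def down_def)
  show "link G (k2 G) r2 r2 \<in> snake_matching G I \<longleftrightarrow> (k2 G \<in> I \<longleftrightarrow> \<not> up G (k2 G))" if "has_loop2 G"
    using levels(2)[OF that] closed[of "k2 G"] d_pos
    by (auto simp: link_in_snake_matching r2_def down_def up_def split: if_splits)
qed

lemma hits_cuts_iff: "snake_closed G I \<Longrightarrow> hits_cuts G (snake_matching G I) \<longleftrightarrow> loop_closed I"
  using cut_edges_in_matching[of I] by (auto simp: hits_cuts_def cut_pairs_link loop_closed_def)

definition matching_of :: "nat set \<Rightarrow> edge set set" where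
  "matching_of I = loop_restriction G (snake_matching G I)"

lemma good_matchings_eq: "good_matchings G = matching_of ` order_ideals G"
proof
  show "good_matchings G \<subseteq> matching_of ` order_ideals G"
  proof
    fix P assume "P \<in> good_matchings G"
    then obtain Q where "loop_perfect_matching G P" "extends_to G P Q"
      by (auto simp: good_matchings_def good_matching_def)
    then have Q: "snake_perfect_matching G Q" "hits_cuts G Q" "P = loop_restriction G Q"
      using extends_to_iff[of P Q] by (auto simp: loop_perfect_matching_def)
    obtain I where "I \<subseteq> tiles G" "snake_closed G I" "Q = snake_matching G I"
      using perfect_matching_is_snake_matching[OF d_pos Q(1)] .
    then show "P \<in> matching_of ` order_ideals G"
      using Q hits_cuts_iff by (auto simp: order_ideals_iff matching_of_def)
  qed
  show "matching_of ` order_ideals G \<subseteq> good_matchings G"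
  proof
    fix P assume "P \<in> matching_of ` order_ideals G"
    then obtain I
      where I: "snake_closed G I" "loop_closed I" "P = loop_restriction G (snake_matching G I)"
      by (auto simp: order_ideals_iff matching_of_def)
    then have "snake_perfect_matching G (snake_matching G I)" "hits_cuts G (snake_matching G I)"
      using snake_matching_perfect[OF d_pos] hits_cuts_iff by auto
    moreover have "P \<subseteq> loop_edges G" using I(3) by (auto simp: loop_restriction_def)
    ultimately show "P \<in> good_matchings G"
      using I(3) extends_to_iff[of P] loop_restriction_perfect
      by (auto simp: good_matchings_def good_matching_def)
  qed
qed

lemma snake_matching_inj:
  assumes "I \<subseteq> tiles G" "J \<subseteq> tiles G" "snake_matching G I = snake_matching G J"
  shows "I = J"
proof -
  have "j \<in> I \<longleftrightarrow> j \<in> J" if j: "j \<in> tiles G" for j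
  proof -
    obtain l where l: "j = Suc l" "l < ntiles G" using j by (cases j) (auto simp: tiles_def)
    then have "link G l (\<not> down I l) (down I (Suc l)) \<in> snake_matching G J"
      unfolding assms(3)[symmetric] by (auto simp: snake_matching_def)
    then have "down I j \<longleftrightarrow> down J j" using l d_pos by (auto simp: link_in_snake_matching)
    then show ?thesis by (auto simp: down_def)
  qed
  then show ?thesis using assms by blast
qed

text \<open>This is the uniqueness of the extension: when a cut edge is not in the good matching, it
  has to be recovered which of its copies was used.\<close>

lemma matching_of_inj:
  assumes I: "I \<in> order_ideals G" and J: "J \<in> order_ideals G" and eq: "matching_of I = matching_of J"
  shows "I = J"
proof -
  let ?M = "snake_matching G"
  have sub: "?M K \<subseteq> snake_edges G" if "K \<in> order_ideals G" for K
    using that snake_matching_perfect[OF d_pos]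
      by (auto simp: order_ideals_iff snake_perfect_matching_def)
  have cls: "edge_class G e \<subseteq> ?M I \<longleftrightarrow> edge_class G e \<subseteq> ?M J" for e
    using eq edge_class_in_restriction[OF sub[OF I]] edge_class_in_restriction[OF sub[OF J]]
    unfolding matching_of_def by metis
  have plain: "e \<in> ?M I \<longleftrightarrow> e \<in> ?M J" if "e \<notin> Field (cut_pairs G)" for e
    using cls[of e] that by (simp add: edge_class_not_cut)
  have hits: "hits_cuts G (?M I)" "hits_cuts G (?M J)"
    using I J hits_cuts_iff by (auto simp: order_ideals_iff)
  text \<open>The edges of the first and last level that are not cut edges decide which outer copies
    of the cut edges belong to the matching.\<close>
  have outer: "c \<in> ?M I \<longleftrightarrow> c \<in> ?M J" if c: "(c, c') \<in> cut_pairs G" for c c'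
  proof -
    consider "has_loop1 G" "c = link G 0 True b1" | "has_loop2 G" "c = link G (ntiles G) b2 True"
      using c by (auto simp: cut_pairs_link split: if_splits)
    then show ?thesis
    proof cases
      case 1
      have "link G 0 True (\<not> b1) \<notin> Field (cut_pairs G)"
        using levels 1 d_pos by (auto simp: cut_pairs_link Field_def link_eq_iff)
      then have "link G 0 True (\<not> b1) \<in> ?M I \<longleftrightarrow> link G 0 True (\<not> b1) \<in> ?M J" by (rule plain)
      then show ?thesis using 1 d_pos by (auto simp: link_in_snake_matching)
    next
      case 2
      have "link G (ntiles G) (\<not> b2) True \<notin> Field (cut_pairs G)"
        using levels 2 d_pos by (auto simp: cut_pairs_link Field_def link_eq_iff)
      then have "link G (ntiles G) (\<not> b2) True \<in> ?M I \<longleftrightarrow> link G (ntiles G) (\<not> b2) True \<in> ?M J"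
        by (rule plain)
      then show ?thesis using 2 d_pos by (auto simp: link_in_snake_matching)
    qed
  qed
  have "e \<in> ?M I \<longleftrightarrow> e \<in> ?M J" for e
  proof (cases "e \<in> Field (cut_pairs G)")
    case True
    then obtain c c' where c: "(c, c') \<in> cut_pairs G" "e = c \<or> e = c'" by (auto simp: Field_def)
    \<comment> \<open>If the outer copy is missing, the inner one is present; if the outer copy is
      present, the class decides about the inner one.\<close>
    have "c \<in> ?M K \<or> c' \<in> ?M K" if "K = I \<or> K = J" for K
      using that hits c(1) by (auto simp: hits_cuts_def)
    then have "c \<in> ?M I \<or> c' \<in> ?M I" "c \<in> ?M J \<or> c' \<in> ?M J" by simp_all
    then show ?thesis
      using outer[OF c(1)] cls[of c] c(2) unfolding edge_class_cut[OF c(1)] insert_subset by blast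
  qed (rule plain)
  then have "?M I = ?M J" by blast
  then show ?thesis using I J snake_matching_inj by (auto simp: order_ideals_iff)
qed

lemma extends_matching_of:
  assumes I: "I \<in> order_ideals G"
  shows "extends_to G (matching_of I) Q \<longleftrightarrow> Q = snake_matching G I"
proof -
  have sub: "matching_of I \<subseteq> loop_edges G" by (auto simp: matching_of_def loop_restriction_def)
  show ?thesis
  proof
    assume "extends_to G (matching_of I) Q"
    then have Q: "snake_perfect_matching G Q" "hits_cuts G Q" "matching_of I = loop_restriction G Q"
      using extends_to_iff[OF sub] by auto
    obtain J where J: "J \<subseteq> tiles G" "snake_closed G J" "Q = snake_matching G J"
      using perfect_matching_is_snake_matching[OF d_pos Q(1)] .
    then have "J \<in> order_ideals G" using Q(2) hits_cuts_iff by (auto simp: order_ideals_iff)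
    then have "I = J" using matching_of_inj[OF I] Q(3) J(3) by (auto simp: matching_of_def)
    then show "Q = snake_matching G I" using J(3) by simp
  next
    assume "Q = snake_matching G I"
    then show "extends_to G (matching_of I) Q"
      using I snake_matching_perfect[OF d_pos] hits_cuts_iff extends_to_iff[OF sub]
      by (auto simp: order_ideals_iff matching_of_def)
  qed
qed

lemma diagonal_walk_exists: "\<exists>w. diagonal_walk G (snake_matching G I) w"
proof -
  \<comment> \<open>At time \<open>2 * i\<close> the walk leaves diagonal \<open>i\<close>, at time
    \<open>2 * i + 1\<close> it enters diagonal \<open>i + 1\<close>.\<close>
  define w where "w n = (if even n then vtx G (n div 2) (\<not> down I (n div 2))
    else vtx G (Suc (n div 2)) (down I (Suc (n div 2))))" for n
  have even: "w (2 * i) = vtx G i (\<not> down I i)" and odd: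
    "w (2 * i + 1) = vtx G (Suc i) (down I (Suc i))" for i
    by (auto simp: w_def)
  have "w (2 * i - 1) = vtx G i (down I i)" if "0 < i" for i
  proof -
    have "2 * i - 1 = 2 * (i - 1) + 1" using that by simp
    then show ?thesis using odd[of "i - 1"] that by simp
  qed
  then have "{w (2 * i - 1), w (2 * i)} = diagonal G i" if "i \<in> tiles G" for i
    using that even[of i] by (cases "down I i") (auto simp: tiles_def diagonal_def vtx_def)
  moreover have "{w (2 * i), w (2 * i + 1)} \<in> snake_matching G I" if "i \<le> ntiles G" for i
    unfolding even odd using that by (auto simp: snake_matching_def link_def)
  moreover have "w 0 = sw G 1" "w (2 * ntiles G + 1) = ne G (ntiles G)"
    unfolding odd by (auto simp: w_def vtx_def)
  ultimately have "diagonal_walk G (snake_matching G I) w" unfolding diagonal_walk_def by simp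
  then show ?thesis by blast
qed

text \<open>The link before diagonal \<open>i\<close> lies in the matching, and its upper flag alone
  determines the end at which the walk enters. Hence no induction along the walk is
  required.\<close>

lemma diagonal_walk_unique:
  assumes w: "diagonal_walk G (snake_matching G I) w" and i: "i \<in> tiles G"
  shows "w (2 * i - 1) = vtx G i (down I i)" "w (2 * i) = vtx G i (\<not> down I i)"
proof -
  have *: "\<exists>a. w (2 * j - 1) = vtx G j (\<not> a) \<and> w (2 * j) = vtx G j a" if "j \<in> tiles G" for j
  proof -
    have "{w (2 * j - 1), w (2 * j)} = {vtx G j True, vtx G j False}"
      using w that by (auto simp: diagonal_walk_def diagonal_def vtx_def tiles_def)
    then show ?thesis by (metis (full_types) doubleton_eq_iff)
  qed
  then obtain a where a: "w (2 * i - 1) = vtx G i (\<not> a)" "w (2 * i) = vtx G i a" using i by blast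
  obtain l where l: "i = Suc l" "l < ntiles G" using i by (cases i) (auto simp: tiles_def)
  obtain x where x: "w (2 * l) = vtx G l x"
  proof (cases "l = 0")
    case True then show ?thesis using w that[of True] by (auto simp: diagonal_walk_def vtx_def)
  next
    case False
    then have "l \<in> tiles G" using l by (auto simp: tiles_def)
    then show ?thesis using * that by blast
  qed
  have "{w (2 * l), w (2 * l + 1)} \<in> snake_matching G I" using w l by (simp add: diagonal_walk_def)
  then have "link G l x (\<not> a) \<in> snake_matching G I" using x a l by (simp add: link_def)
  then have "a = (\<not> down I i)" using l d_pos by (auto simp: link_in_snake_matching)
  then show "w (2 * i - 1) = vtx G i (down I i)" "w (2 * i) = vtx G i (\<not> down I i)" using a by auto
qed

lemma height_matching_of:
  assumes I: "I \<in> order_ideals G"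
  shows "height G (matching_of I) = I"
proof -
  have *: "oriented_down G (matching_of I) i \<longleftrightarrow> down I i" "oriented_up G (matching_of I) i \<longleftrightarrow> \<not> down I i"
    if i: "i \<in> tiles G" for i
  proof -
    have v: "nw G i = vtx G i True" "se G i = vtx G i False" "vtx G i True \<noteq> vtx G i False"
      using i corner_vtx[of i G] d_pos by (auto simp: tiles_def vtx_eq_iff)
    obtain w where "diagonal_walk G (snake_matching G I) w" using diagonal_walk_exists by blast
    then have "(\<exists>Q w. extends_to G (matching_of I) Q \<and> diagonal_walk G Q w \<and> w (2 * i - 1) = x
      \<and> w (2 * i) = y)
        \<longleftrightarrow> x = vtx G i (down I i) \<and> y = vtx G i (\<not> down I i)" for x y
      unfolding extends_matching_of[OF I] using diagonal_walk_unique[OF _ i] by metis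
    then show "oriented_down G (matching_of I) i \<longleftrightarrow> down I i"
      "oriented_up G (matching_of I) i \<longleftrightarrow> \<not> down I i"
      using v unfolding oriented_down_def oriented_up_def by (cases "down I i"; simp)+
  qed
  have "positive_diagonal G (matching_of I) i \<longleftrightarrow> i \<in> I" if "i \<in> tiles G" for i
    using *[OF that] by (cases "even i") (auto simp: positive_diagonal_def rel_def down_def)
  then show ?thesis using I by (auto simp: height_def order_ideals_iff)
qed

section \<open>Twists\<close>

definition before_twist :: "nat \<Rightarrow> edge set" where
  "before_twist j = tile_edge G j ` (if odd j then {North, South} else {West, East})"

definition after_twist :: "nat \<Rightarrow> edge set" where
  "after_twist j = tile_edge G j ` (if odd j then {West, East} else {North, South})"

text \<open>The snake arrows at \<open>j\<close> have their tails in \<open>I\<close> when they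
  point to \<open>j\<close>, and their heads outside \<open>I\<close> when they leave
  \<open>j\<close>. Membership of \<open>j\<close> does not occur, so the same condition serves
  before and after the twist.\<close>

definition twistable :: "nat set \<Rightarrow> nat \<Rightarrow> bool" where
  "twistable I j \<longleftrightarrow> (j = 1 \<or> (j - 1 \<in> I \<longleftrightarrow> up G (j - 1))) \<and> (j = ntiles G \<or> (Suc j \<in> I \<longleftrightarrow> \<not> up G j))"

lemma positive_twist_at_iff:
  "positive_twist_at G j P P' \<longleftrightarrow>
     replace_edges (edge_class G ` before_twist j) (edge_class G ` after_twist j) P P'"
  by (auto simp: positive_twist_at_def before_twist_def after_twist_def)

text \<open>One side of the tile in the matching already fixes the orientation of its diagonal,
  hence membership of \<open>j\<close>; a pair of opposite sides also fixes both neighbours.\<close>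

lemma tile_edge_in_matching:
  assumes "j \<in> tiles G"
  shows "e \<in> before_twist j \<Longrightarrow> e \<in> snake_matching G I \<Longrightarrow> j \<notin> I"
    "e \<in> after_twist j \<Longrightarrow> e \<in> snake_matching G I \<Longrightarrow> j \<in> I"
    "before_twist j \<subseteq> snake_matching G I \<longleftrightarrow> j \<notin> I \<and> twistable I j"
    "after_twist j \<subseteq> snake_matching G I \<longleftrightarrow> j \<in> I \<and> twistable I j"
proof -
  obtain l where l: "j = Suc l" "l < ntiles G" using assms by (cases j) (auto simp: tiles_def)
  note defs = before_twist_def after_twist_def twistable_def link_in_snake_matching down_def up_def
  show "e \<in> before_twist j \<Longrightarrow> e \<in> snake_matching G I \<Longrightarrow> j \<notin> I"
    using l d_pos tile_edge_link[of j G] by (auto simp: defs split: if_splits)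
  show "e \<in> after_twist j \<Longrightarrow> e \<in> snake_matching G I \<Longrightarrow> j \<in> I"
    using l d_pos tile_edge_link[of j G] by (auto simp: defs split: if_splits)
  show "before_twist j \<subseteq> snake_matching G I \<longleftrightarrow> j \<notin> I \<and> twistable I j"
    using l d_pos tile_edge_link[of j G] by (auto simp: defs)
  show "after_twist j \<subseteq> snake_matching G I \<longleftrightarrow> j \<in> I \<and> twistable I j"
    using l d_pos tile_edge_link[of j G] by (auto simp: defs)
qed

text \<open>Arrows leaving \<open>j\<close> are restricted by closedness of \<open>I\<close>, arrows
  into \<open>j\<close> by closedness of \<open>insert j I\<close>.\<close>

lemma snake_closed_insert_iff:
  assumes "snake_closed G I" "j \<in> tiles G" "j \<notin> I"
  shows "snake_closed G (insert j I) \<longleftrightarrow> twistable I j"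
proof
  assume ins: "snake_closed G (insert j I)"
  have "j - 1 \<in> I \<longleftrightarrow> up G (j - 1)" if "j \<noteq> 1"
  proof -
    obtain l where l: "j = Suc l" "0 < l" "l < ntiles G"
      using \<open>j \<noteq> 1\<close> assms(2) by (cases j) (auto simp: tiles_def)
    then show ?thesis using assms ins unfolding snake_closed_def
      by (metis diff_Suc_1 insert_iff n_not_Suc_n)
  qed
  moreover have "Suc j \<in> I \<longleftrightarrow> \<not> up G j" if "j \<noteq> ntiles G"
  proof -
    have "0 < j" "j < ntiles G" using that assms(2) by (auto simp: tiles_def)
    then show ?thesis using assms ins unfolding snake_closed_def
      by (metis insert_iff n_not_Suc_n)
  qed
  ultimately show "twistable I j" unfolding twistable_def by blast
next
  assume tw: "twistable I j"
  show "snake_closed G (insert j I)"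
    unfolding snake_closed_def
  proof (intro allI impI)
    fix l assume l: "0 < l \<and> l < ntiles G"
    have "if up G l then Suc l \<in> I \<longrightarrow> l \<in> I else l \<in> I \<longrightarrow> Suc l \<in> I"
      using assms(1) l by (simp add: snake_closed_def)
    then show "if up G l then Suc l \<in> insert j I \<longrightarrow> l \<in> insert j I else l \<in> insert j I
      \<longrightarrow> Suc l \<in> insert j I"
      using tw l unfolding twistable_def by (cases "j = l"; cases "j = Suc l") auto
  qed
qed

text \<open>Each pair of opposite sides of tile \<open>j\<close> has one edge on each of the link
  levels \<open>j - 1\<close> and \<open>j\<close>, and a matching has only one edge per link level.
  The other edges do not depend on membership of \<open>j\<close>.\<close>

lemma snake_matching_twist:
  assumes j: "j \<in> tiles G" "j \<notin> I" and tw: "twistable I j"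
  shows "snake_matching G I - before_twist j = snake_matching G (insert j I) - after_twist j"
proof -
  have same_level: "e = f" if "e \<in> snake_matching G K" "f \<in> snake_matching G K" "e = link G l a b"
    "f = link G l a' b'" "l \<le> ntiles G"
    for e f K l a b a' b'
    using that d_pos by (auto simp: link_in_snake_matching link_eq_iff)
  have tw': "twistable (insert j I) j" using tw j by (auto simp: twistable_def tiles_def)
  have before: "before_twist j \<subseteq> snake_matching G I" and after:
    "after_twist j \<subseteq> snake_matching G (insert j I)"
    using tile_edge_in_matching[OF j(1)] tw tw' j(2) by auto
  have j': "0 < j" "j \<le> ntiles G" using j by (auto simp: tiles_def)
  have lev: "\<exists>e\<in>B. \<exists>a b. e = link G l a b"
    if "B = before_twist j \<or> B = after_twist j" "l = j - 1 \<or> l = j" for B l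
    using that tile_edge_link[OF j'] unfolding before_twist_def after_twist_def
      by (auto split: if_splits)
  have move: "e \<in> snake_matching G K'"
    if B: "B = before_twist j \<or> B = after_twist j" "B \<subseteq> snake_matching G K" and e:
      "e \<in> snake_matching G K" "e \<notin> B"
      and K: "\<And>i. i \<noteq> j \<Longrightarrow> i \<in> K \<longleftrightarrow> i \<in> K'" for B e K K'
  proof -
    obtain l where l: "l \<le> ntiles G" "e = link G l (\<not> down K l) (down K (Suc l))"
      using e(1) by (auto simp: snake_matching_def)
    have "l \<noteq> j - 1 \<and> l \<noteq> j"
    proof (rule ccontr)
      assume "\<not> ?thesis"
      then obtain f a b where f: "f \<in> B" "f = link G l a b" using lev[OF B(1), of l] by blast
      then have "e = f" using same_level[OF e(1) _ l(2) f(2) l(1)] B(2) by blast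
      then show False using e f by simp
    qed
    then have "l \<noteq> j" "Suc l \<noteq> j" by auto
    then have "down K l = down K' l" "down K (Suc l) = down K' (Suc l)"
      using K[of l] K[of "Suc l"] by (auto simp: down_def)
    then show ?thesis using l by (auto simp: snake_matching_def)
  qed
  have no: "e \<notin> before_twist j" if "e \<in> snake_matching G (insert j I)" for e
    using tile_edge_in_matching(1)[OF j(1) _ that] by blast
  have no': "e \<notin> after_twist j" if "e \<in> snake_matching G I" for e
    using tile_edge_in_matching(2)[OF j(1) _ that] j(2) by blast
  show ?thesis
    using move[of "before_twist j" I _ "insert j I"] move[of "after_twist j" "insert j I" _ I]
      before after no no' by blast
qed

text \<open>The sides of a tile occupy two consecutive link levels, whereas those of the two copies
  differ by at least 2.\<close>

lemma cut_edges_different_tiles: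
  assumes "(c, c') \<in> cut_pairs G" "j \<in> tiles G" "tile_edge G j s = c" "tile_edge G j s' = c'"
  shows False
proof -
  have s: "\<exists>l a b. tile_edge G j s = link G l a b \<and> (l = j - 1 \<or> l = j)" for s
    using tile_edge_link[of j G] assms(2) by (cases s) (auto simp: tiles_def)
  obtain l a b where l: "c = link G l a b" "l = j - 1 \<or> l = j" using s assms(3) by metis
  obtain l' a' b' where l': "c' = link G l' a' b'" "l' = j - 1 \<or> l' = j" using s assms(4) by metis
  have "l \<le> ntiles G" "l' \<le> ntiles G" using l l' assms(2) by (auto simp: tiles_def)
  then have "l + 2 \<le> l' \<or> l' + 2 \<le> l"
    using assms(1) l(1) l'(1) levels d_pos by (auto simp: cut_pairs_link link_eq_iff split: if_splits)
  then show False using l l' by auto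
qed

text \<open>The critical case is an exchanged edge that is a copy of a cut edge, since its class has
  to lie entirely in its matching. The other matching lacks this copy, hence contains the other
  copy; that one is outside \<open>X \<union> Y\<close> and so belongs to both matchings.\<close>

lemma restriction_twist:
  assumes sub: "M \<subseteq> snake_edges G" "M' \<subseteq> snake_edges G" and hits: "hits_cuts G M" "hits_cuts G M'"
    and X: "X \<subseteq> M" "X \<inter> M' = {}" and Y: "Y \<subseteq> M'" "Y \<inter> M = {}" and eq: "M - X = M' - Y"
    and tile: "\<And>c c'. \<lbrakk>(c, c') \<in> cut_pairs G; c \<in> X \<union> Y; c' \<in> X \<union> Y\<rbrakk> \<Longrightarrow> False"
  shows "replace_edges (edge_class G ` X) (edge_class G ` Y) (loop_restriction G M) (loop_restriction G
    M')"
proof -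
  have classes: "edge_class G e \<subseteq> N"
    if "e \<in> X'" "X' \<subseteq> N" "X' \<inter> N' = {}" "hits_cuts G N'" "N' - Y' = N - X'"
      "X' \<union> Y' = X \<union> Y" for e N N' X' Y'
  proof (cases "e \<in> Field (cut_pairs G)")
    case True
    then obtain c c' where c: "(c, c') \<in> cut_pairs G" "e = c \<or> e = c'" by (auto simp: Field_def)
    have hit: "c \<in> N' \<or> c' \<in> N'" using c that(4) by (auto simp: hits_cuts_def)
    have "e \<in> X \<union> Y" "e \<in> N" "e \<notin> N'" using that(1-3,6) by auto
    then obtain f where f: "edge_class G e = {e, f}" "f \<in> N'" "f \<notin> X \<union> Y"
      using c(2) hit edge_class_cut[OF c(1)] tile[OF c(1)] by blast
    then have "f \<in> N' - Y'" using that(6) by auto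
    then have "f \<in> N" unfolding that(5) by simp
    then show ?thesis using f(1) \<open>e \<in> N\<close> by simp
  next
    case False
    then show ?thesis using that by (auto simp: edge_class_not_cut)
  qed
  have removed: "F \<in> loop_restriction G N' - edge_class G ` Y'"
    if F: "F \<in> loop_restriction G N - edge_class G ` X'" and N: "N - X' = N' - Y'" "Y' \<inter> N = {}"
    for F N N' X' Y'
  proof -
    obtain h where h: "F = edge_class G h" using F by (auto simp: loop_restriction_def loop_edges_iff)
    then have F': "F = edge_class G e" if "e \<in> F" for e using that edge_class_eq[of e h] by simp
    have "F \<subseteq> N" using F by (simp add: loop_restriction_def)
    then have "F \<subseteq> N - X'" using F F' by blast
    then have "F \<subseteq> N'" using N by blast
    moreover have "F \<notin> edge_class G ` Y'" using \<open>F \<subseteq> N\<close> N(2) edge_class_self by blast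
    ultimately show ?thesis using F by (auto simp: loop_restriction_def)
  qed
  have "edge_class G ` X \<subseteq> loop_restriction G M"
    using classes[of _ X M M' Y] X eq hits edge_class_in_restriction[OF sub(1)] by auto
  moreover have "edge_class G ` Y \<subseteq> loop_restriction G M'"
  proof
    fix F assume "F \<in> edge_class G ` Y"
    then obtain e where "e \<in> Y" "F = edge_class G e" by blast
    then show "F \<in> loop_restriction G M'"
      using classes[of e Y M' M X] Y eq hits(1) edge_class_in_restriction[OF sub(2), of e]
      by (simp add: Un_commute)
  qed
  moreover have "loop_restriction G M - edge_class G ` X = loop_restriction G M' - edge_class G ` Y"
    using removed[of _ M X M' Y, OF _ eq Y(2)] removed[of _ M' Y M X, OF _ eq[symmetric] X(2)]
    by (rule equalityI[OF subsetI subsetI])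
  ultimately show ?thesis unfolding replace_edges_def by blast
qed

lemma twist_insert:
  assumes I: "I \<in> order_ideals G" and I': "insert j I \<in> order_ideals G" and j: "j \<notin> I"
  shows "positive_twist_at G j (matching_of I) (matching_of (insert j I))"
proof -
  have jt: "j \<in> tiles G" using I' by (auto simp: order_ideals_iff)
  have tw: "twistable I j" using I I' j jt snake_closed_insert_iff by (auto simp: order_ideals_iff)
  then have tw': "twistable (insert j I) j" using jt by (auto simp: twistable_def tiles_def)
  note in_matching = tile_edge_in_matching[OF jt]
  have sub: "snake_matching G K \<subseteq> snake_edges G" "hits_cuts G (snake_matching G K)"
    if "K \<in> order_ideals G" for K
    using that snake_matching_perfect[OF d_pos] hits_cuts_iff
    by (auto simp: order_ideals_iff snake_perfect_matching_def)
  show ?thesis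
    unfolding positive_twist_at_iff matching_of_def
  proof (rule restriction_twist)
    show "before_twist j \<subseteq> snake_matching G I" using in_matching(3) tw j by blast
    show "after_twist j \<subseteq> snake_matching G (insert j I)" using in_matching(4) tw' by blast
    show "before_twist j \<inter> snake_matching G (insert j I) = {}" using in_matching(1) by blast
    show "after_twist j \<inter> snake_matching G I = {}" using in_matching(2) j by blast
    show "snake_matching G I - before_twist j = snake_matching G (insert j I) - after_twist j"
      by (rule snake_matching_twist[OF jt j tw])
    fix c c' assume c: "(c, c') \<in> cut_pairs G" "c \<in> before_twist j \<union> after_twist j"
      "c' \<in> before_twist j \<union> after_twist j"
    have "before_twist j \<union> after_twist j \<subseteq> range (tile_edge G j)"
      unfolding before_twist_def after_twist_def by blast
    then obtain s s' where "tile_edge G j s = c" "tile_edge G j s' = c'" using c by blast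
    then show False using cut_edges_different_tiles[OF c(1) jt] by blast
  qed (use sub I I' in auto)
qed

text \<open>The cut edge is removed by the positive twist at the head of the arrow of the loop. Here
  the head is the inner tile, in the next lemma the outer one.\<close>

lemma inner_cut_in_before_twist:
  "has_loop1 G \<Longrightarrow> \<not> up G (k1 G - 1) \<Longrightarrow> link G (k1 G - 1) r1 r1 \<in> before_twist (k1 G)"
  "has_loop2 G \<Longrightarrow> up G (k2 G) \<Longrightarrow> link G (k2 G) r2 r2 \<in> before_twist (k2 G)"
  using tile_edge_link[of "k1 G" G] tile_edge_link[of "k2 G" G] levels k1_pos
  by (auto simp: before_twist_def up_def r1_def r2_def)

lemma outer_cut_in_before_twist:
  "has_loop1 G \<Longrightarrow> up G (k1 G - 1) \<Longrightarrow> link G 0 True b1 \<in> before_twist 1"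
  "has_loop2 G \<Longrightarrow> \<not> up G (k2 G) \<Longrightarrow> link G (ntiles G) b2 True \<in> before_twist (ntiles G)"
  using tile_edge_link[of 1 G] tile_edge_link[of "ntiles G" G] d_pos
    link_0[of G "\<not> right G 0" False True] link_last[of G _ "right G (ntiles G)" True]
  by (auto simp: before_twist_def b1_def b2_def)

text \<open>The snake arrows are handled by \<open>twistable\<close>. If \<open>j\<close> is the
  head of the arrow of a loop, the cut edge is among the removed edges, so both of its copies are in
  the matching; the copy at the other tile says that the tail lies in \<open>I\<close>.\<close>

lemma insert_order_ideal:
  assumes I: "I \<in> order_ideals G" and j: "j \<in> tiles G"
    and classes: "\<And>e. e \<in> before_twist j \<Longrightarrow> edge_class G e \<subseteq> snake_matching G I"
  shows "j \<notin> I" "insert j I \<in> order_ideals G"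
proof -
  have "before_twist j \<subseteq> snake_matching G I" using classes edge_class_self by blast
  then have tw: "j \<notin> I" "twistable I j" using tile_edge_in_matching(3)[OF j] by auto
  then show "j \<notin> I" by simp
  have snake: "snake_closed G I" and loop: "loop_closed I" using I by (auto simp: order_ideals_iff)
  have both: "c \<in> snake_matching G I \<and> c' \<in> snake_matching G I"
    if "(c, c') \<in> cut_pairs G" "c \<in> before_twist j \<or> c' \<in> before_twist j" for c c'
    using classes[of c] classes[of c'] that(2) edge_class_cut[OF that(1)] by auto
  note cuts = cut_edges_in_matching[OF snake]
  have pair1: "(link G 0 True b1, link G (k1 G - 1) r1 r1) \<in> cut_pairs G" if "has_loop1 G"
    using that by (simp add: cut_pairs_link)
  have pair2: "(link G (ntiles G) b2 True, link G (k2 G) r2 r2) \<in> cut_pairs G" if "has_loop2 G"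
    using that by (simp add: cut_pairs_link)
  have "loop_closed (insert j I)"
    unfolding loop_closed_def
  proof (intro conjI impI)
    assume L: "has_loop1 G"
    show "if up G (k1 G - 1) then 1 \<in> insert j I \<longrightarrow> k1 G \<in> insert j I else k1 G \<in> insert j I
      \<longrightarrow> 1 \<in> insert j I"
    proof (cases "up G (k1 G - 1)")
      case True
      then have "k1 G \<in> I" if "j = 1"
        using both[OF pair1[OF L]] outer_cut_in_before_twist(1)[OF L True] cuts(2)[OF L] that by simp
      then show ?thesis using loop L True by (auto simp: loop_closed_def)
    next
      case False
      then have "1 \<in> I" if "j = k1 G"
        using both[OF pair1[OF L]] inner_cut_in_before_twist(1)[OF L False] cuts(1)[OF L] that by simp
      then show ?thesis using loop L False by (auto simp: loop_closed_def)
    qed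
  next
    assume L: "has_loop2 G"
    show "if up G (k2 G) then k2 G \<in> insert j I \<longrightarrow> ntiles G \<in> insert j I else ntiles G \<in> insert j I
      \<longrightarrow> k2 G \<in> insert j I"
    proof (cases "up G (k2 G)")
      case True
      then have "ntiles G \<in> I" if "j = k2 G"
        using both[OF pair2[OF L]] inner_cut_in_before_twist(2)[OF L True] cuts(3)[OF L] that by simp
      then show ?thesis using loop L True by (auto simp: loop_closed_def)
    next
      case False
      then have "k2 G \<in> I" if "j = ntiles G"
        using both[OF pair2[OF L]] outer_cut_in_before_twist(2)[OF L False] cuts(4)[OF L] that by simp
      then show ?thesis using loop L False by (auto simp: loop_closed_def)
    qed
  qed
  then show "insert j I \<in> order_ideals G"
    using I j tw snake_closed_insert_iff[OF snake j] by (auto simp: order_ideals_iff)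
qed

lemma twist_arrows_iff:
  assumes I: "I \<in> order_ideals G" and J: "J \<in> order_ideals G"
  shows "(matching_of I, matching_of J) \<in> twist_arrows G \<longleftrightarrow> (\<exists>j. j \<notin> I \<and> J = insert j I)"
proof
  assume "(matching_of I, matching_of J) \<in> twist_arrows G"
  then obtain j where j: "j \<in> tiles G" "positive_twist_at G j (matching_of I) (matching_of J)"
    by (auto simp: twist_arrows_def)
  have "edge_class G e \<subseteq> snake_matching G I" if "e \<in> before_twist j" for e
    using j(2) that unfolding positive_twist_at_iff replace_edges_def
    by (auto simp: matching_of_def loop_restriction_def)
  then have j': "j \<notin> I" "insert j I \<in> order_ideals G" using insert_order_ideal[OF I j(1)] by auto
  have "positive_twist_at G j (matching_of I) (matching_of (insert j I))"
    by (rule twist_insert[OF I j'(2,1)])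
  \<comment> \<open>A replacement determines its result, so a twist at \<open>j\<close> has only one
    possible target.\<close>
  moreover have "P' = (P - X) \<union> Y" if "replace_edges X Y P P'" for X Y P P' :: "edge set set"
    using that unfolding replace_edges_def by blast
  ultimately have "matching_of J = matching_of (insert j I)"
    using j(2) unfolding positive_twist_at_iff by metis
  then show "\<exists>j. j \<notin> I \<and> J = insert j I" using matching_of_inj[OF J j'(2)] j'(1) by blast
next
  assume "\<exists>j. j \<notin> I \<and> J = insert j I"
  then obtain j where j: "j \<notin> I" "J = insert j I" by blast
  then have "j \<in> tiles G" using J by (auto simp: order_ideals_iff)
  moreover have "good_matching G (matching_of I)" "good_matching G (matching_of J)"
    using good_matchings_eq I J by (auto simp: good_matchings_def)
  ultimately show "(matching_of I, matching_of J) \<in> twist_arrows G"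
    using twist_insert[OF I _ j(1)] J j(2) by (auto simp: twist_arrows_def)
qed

text \<open>A rank function for the quiver, which therefore is acyclic.  Its steps along the snake have
  length 2, except for those from \<open>k1 - 1\<close> to \<open>k1\<close> and from \<open>k2\<close> to \<open>k2 + 1\<close>, which point
  against the adjacent hook; being short, they do not outweigh it.\<close>

definition arrow_rank :: "nat \<Rightarrow> int" where
  "arrow_rank j = (\<Sum>l=1..<j.
     if has_loop1 G \<and> Suc l = k1 G \<or> has_loop2 G \<and> l = k2 G then if up G l then 1 else -1
     else if up G l then 2 else -2)"

lemma arrow_rank_mono:
  assumes "(y, x) \<in> loop_quiver G"
  shows "arrow_rank y < arrow_rank x"
proof -
  define s :: "nat \<Rightarrow> int" where "s l =
     (if has_loop1 G \<and> Suc l = k1 G \<or> has_loop2 G \<and> l = k2 G then if up G l then 1 else -1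
      else if up G l then 2 else -2)" for l
  have rank: "arrow_rank j = (\<Sum>l=1..<j. s l)" for j by (simp only: arrow_rank_def s_def)
  have split: "arrow_rank m = arrow_rank n + (\<Sum>l=n..<m. s l)" if "1 \<le> n" "n \<le> m" for n m
    unfolding rank using that by (simp add: sum.atLeastLessThan_concat)
  have step: "arrow_rank (Suc l) = arrow_rank l + s l" if "0 < l" for l
    using split[of l "Suc l"] that by simp
  consider (snake) l where "0 < l" "(y, x) = (if up G l then (l, Suc l) else (Suc l, l))"
    | (first) "has_loop1 G" "(y, x) = (if up G (k1 G - 1) then (k1 G, 1) else (1, k1 G))"
    | (second) "has_loop2 G" "(y, x) = (if up G (k2 G) then (ntiles G, k2 G) else (k2 G, ntiles G))"
    using assms unfolding loop_quiver_iff snake_quiver_iff by blast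
  then show ?thesis
  proof cases
    case (snake l)
    have "if up G l then 0 < s l else s l < 0" by (simp add: s_def)
    then show ?thesis using snake step[OF snake(1)] by (cases "up G l") simp_all
  next
    case first
    note lev = levels(1)[OF first(1)]
    obtain m where m: "k1 G = Suc m" "2 \<le> m" using lev by (cases "k1 G") auto
    define e :: int where "e = (if up G m then 1 else -1)"
    have "s l = - 2 * e" if "l \<in> {1..<m}" for l
    proof -
      have l: "0 < l" "Suc l < k1 G" "Suc l \<noteq> k1 G" "l \<noteq> k2 G" using that lev m by auto
      have "up G l \<longleftrightarrow> \<not> up G m" using loop1(3)[OF first(1) l(1,2)] m by simp
      then show ?thesis using l(3,4) unfolding s_def e_def by (cases "up G m") simp_all
    qed
    then have "arrow_rank m = (\<Sum>l=1..<m. - 2 * e)" unfolding rank by (intro sum.cong) simp_all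
    also have "\<dots> = - 2 * (int m - 1) * e" using m by (simp add: algebra_simps)
    \<comment> \<open>The \<open>m - 1\<close> steps of the hook contribute \<open>-2 * e\<close>
      each and the short step \<open>e\<close>. As \<open>2 \<le> m\<close>, the coefficient is
      negative.\<close>
    finally have "arrow_rank (k1 G) = (3 - 2 * int m) * e"
      using step[of m] m first(1) by (simp add: s_def e_def algebra_simps)
    moreover have "arrow_rank 1 = 0" by (simp add: rank)
    ultimately show ?thesis using first(2) m by (cases "up G m") (simp_all add: e_def)
  next
    case second
    note lev = levels(2)[OF second(1)]
    define e :: int where "e = (if up G (k2 G) then 1 else -1)"
    have "s l = - 2 * e" if "l \<in> {Suc (k2 G)..<ntiles G}" for l
    proof -
      have l: "k2 G < l" "l < ntiles G" "Suc l \<noteq> k1 G" "l \<noteq> k2 G" using that lev by auto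
      show ?thesis using l(3,4) loop2(3)[OF second(1) l(1,2)]
        unfolding s_def e_def by (cases "up G (k2 G)") simp_all
    qed
    then have "(\<Sum>l=Suc (k2 G)..<ntiles G. s l) = (\<Sum>l=Suc (k2 G)..<ntiles G. - 2 * e)"
      by (intro sum.cong) simp_all
    also have "\<dots> = - 2 * (int (ntiles G) - int (k2 G) - 1) * e" using lev
      by (simp add: of_nat_diff algebra_simps)
    finally have
      "arrow_rank (ntiles G) = arrow_rank (k2 G) + e - 2 * (int (ntiles G) - int (k2 G) - 1) * e"
      using step[of "k2 G"] split[of "Suc (k2 G)" "ntiles G"] lev second(1)
        by (simp add: s_def e_def algebra_simps)
    then show ?thesis using second(2) lev by (cases "up G (k2 G)") (simp_all add: e_def)
  qed
qed

text \<open>For \<open>x\<close> of minimal rank in \<open>J - I\<close>, every tail of an arrow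
  into \<open>x\<close> lies in \<open>J\<close> and has smaller rank, hence lies in
  \<open>I\<close>.\<close>

lemma ideal_step:
  assumes I: "I \<in> order_ideals G" and J: "J \<in> order_ideals G" and IJ: "I \<subset> J"
  obtains x where "x \<in> J - I" "insert x I \<in> order_ideals G"
proof -
  have "finite J" using J by (auto simp: order_ideals_iff tiles_def intro: finite_subset)
  moreover define x where "x = arg_min_on arrow_rank (J - I)"
  ultimately have x: "x \<in> J - I" "\<not> (\<exists>y\<in>J - I. arrow_rank y < arrow_rank x)"
    using arg_min_if_finite[of "J - I" arrow_rank] IJ by auto
  have "y \<in> insert x I" if yz: "(y, z) \<in> loop_quiver G" "z \<in> insert x I" for y z
  proof (cases "z \<in> I")
    case True
    then show ?thesis using I yz by (auto simp: order_ideals_arrows)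
  next
    case False
    then have "(y, x) \<in> loop_quiver G" using yz by auto
    then have "y \<in> J" "arrow_rank y < arrow_rank x" using J x(1) arrow_rank_mono
      by (auto simp: order_ideals_arrows)
    then show ?thesis using x(2) by blast
  qed
  then have "insert x I \<in> order_ideals G" using I J x(1) by (auto simp: order_ideals_arrows)
  then show thesis using that x(1) by blast
qed

section \<open>Paths and arrows of twists as inclusions and covers of heights\<close>

lemma twist_path_iff:
  assumes I: "I \<in> order_ideals G" and J: "J \<in> order_ideals G"
  shows "(matching_of I, matching_of J) \<in> (twist_arrows G)\<^sup>* \<longleftrightarrow> I \<subseteq> J"
proof
  have "\<forall>K\<in>order_ideals G. P = matching_of K \<longrightarrow> I \<subseteq> K"
    if "(matching_of I, P) \<in> (twist_arrows G)\<^sup>*" for P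
    using that
  proof (induction rule: rtrancl_induct)
    case base
    then show ?case using matching_of_inj[OF I] by blast
  next
    case (step P P')
    then have "P \<in> good_matchings G" by (auto simp: twist_arrows_def good_matchings_def)
    then obtain K where K: "K \<in> order_ideals G" "P = matching_of K"
      unfolding good_matchings_eq by blast
    then show ?case using step twist_arrows_iff[OF K(1)] by blast
  qed
  then show "(matching_of I, matching_of J) \<in> (twist_arrows G)\<^sup>* \<Longrightarrow> I \<subseteq> J" using J by blast
next
  assume "I \<subseteq> J"
  have fin: "finite J" using J by (auto simp: order_ideals_iff tiles_def intro: finite_subset)
  show "(matching_of I, matching_of J) \<in> (twist_arrows G)\<^sup>*"
    using I \<open>I \<subseteq> J\<close>
  proof (induction "card (J - I)" arbitrary: I rule: less_induct)
    case less
    show ?case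
    proof (cases "I = J")
      case False
      then have "I \<subset> J" using less.prems by blast
      then obtain x where x: "x \<in> J - I" "insert x I \<in> order_ideals G"
        using ideal_step[OF less.prems(1) J] by blast
      have "J - insert x I \<subset> J - I" using x by blast
      then have "card (J - insert x I) < card (J - I)" using fin by (intro psubset_card_mono) auto
      then have "(matching_of (insert x I), matching_of J) \<in> (twist_arrows G)\<^sup>*"
        using less.hyps[of "insert x I"] x less.prems by blast
      moreover have "(matching_of I, matching_of (insert x I)) \<in> twist_arrows G"
        using twist_arrows_iff[OF less.prems(1) x(2)] x(1) by blast
      ultimately show ?thesis by (rule converse_rtrancl_into_rtrancl[rotated])
    qed simp
  qed
qed

lemma cover_iff:
  assumes I: "I \<in> order_ideals G" and J: "J \<in> order_ideals G"
  shows "(\<exists>j. j \<notin> I \<and> J = insert j I) \<longleftrightarrow> I \<subset> J \<and> \<not> (\<exists>K\<in>order_ideals G. I \<subset> K \<and> K \<subset> J)"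
proof
  assume "I \<subset> J \<and> \<not> (\<exists>K\<in>order_ideals G. I \<subset> K \<and> K \<subset> J)"
  moreover then obtain x where "x \<in> J - I" "insert x I \<in> order_ideals G"
    using ideal_step[OF I J] by blast
  ultimately show "\<exists>j. j \<notin> I \<and> J = insert j I" by blast
qed blast

theorem loop_graph_lattice:
  "bij_betw (height G) (good_matchings G) (order_ideals G)"
  "\<lbrakk>P \<in> good_matchings G; P' \<in> good_matchings G\<rbrakk> \<Longrightarrow>
    (P, P') \<in> (twist_arrows G)\<^sup>* \<longleftrightarrow> height G P \<subseteq> height G P'"
  "\<lbrakk>P \<in> good_matchings G; P' \<in> good_matchings G\<rbrakk> \<Longrightarrow>
    (P, P') \<in> twist_arrows G \<longleftrightarrow> height G P \<subset> height G P' \<and>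
      \<not> (\<exists>I\<in>order_ideals G. height G P \<subset> I \<and> I \<subset> height G P')"
proof -
  show "bij_betw (height G) (good_matchings G) (order_ideals G)"
    unfolding good_matchings_eq
    by (rule bij_betw_byWitness[where f' = matching_of]) (auto simp: height_matching_of)
  assume P: "P \<in> good_matchings G" "P' \<in> good_matchings G"
  then obtain I J where I: "I \<in> order_ideals G" "P = matching_of I"
    and J: "J \<in> order_ideals G" "P' = matching_of J"
    unfolding good_matchings_eq by blast
  show "(P, P') \<in> (twist_arrows G)\<^sup>* \<longleftrightarrow> height G P \<subseteq> height G P'"
    using I J twist_path_iff height_matching_of by simp
  show "(P, P') \<in> twist_arrows G \<longleftrightarrow> height G P \<subset> height G P' \<and>
      \<not> (\<exists>I\<in>order_ideals G. height G P \<subset> I \<and> I \<subset> height G P')"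
    using I J twist_arrows_iff cover_iff height_matching_of by simp
qed

end

section \<open>Triangulated surfaces\<close>

lemma less_3_cases: "(i::nat) < 3 \<Longrightarrow> i = 0 \<or> i = 1 \<or> i = 2"
  by auto

fun far_side :: "'t corner \<Rightarrow> 't side" where
  "far_side (t, i) = (t, (i + 1) mod 3)"

lemma far_side_opposite_corner: "snd s < 3 \<Longrightarrow> far_side (opposite_corner s) = s"
  by (cases s) (auto dest!: less_3_cases)

lemma far_side_not_spoke: "snd C < 3 \<Longrightarrow> far_side C \<noteq> spoke b C"
  by (cases C) (auto dest!: less_3_cases)

lemma opposite_corner_less_3: "snd (opposite_corner s) < 3"
  by (cases s) auto

section \<open>Turns of a curve and arrows of the quiver\<close>

lemma tile_side_SW:
  assumes "zs ! (j - 1) = (t, i)"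
  shows "tile_side T zs j West = (t, (i + (if odd j then 1 else 2)) mod 3)"
    "tile_side T zs j South = (t, (i + (if odd j then 2 else 1)) mod 3)"
  using assms by (auto simp: tile_side_def rel_def Let_def split: prod.splits)

lemma tile_side_NE:
  assumes "opp_side T (zs ! (j - 1)) = (t, i)"
  shows "tile_side T zs j East = (t, (i + (if odd j then 1 else 2)) mod 3)"
    "tile_side T zs j North = (t, (i + (if odd j then 2 else 1)) mod 3)"
  using assms by (auto simp: tile_side_def rel_def Let_def split: prod.splits)

text \<open>The parity in \<open>up\<close> compensates for the alternating orientation of the
  tiles. What remains is the sense of the turn: \<open>up\<close> means that the curve passes
  counterclockwise around the common corner of the side of entry and the side of exit.\<close>

lemma up_iff_turn:
  assumes "is_snake_graph_of T zs G" "0 < j" "j < ntiles G"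
    and "opp_side T (zs ! (j - 1)) = (t, i)" "zs ! j = (t, i')" "i < 3" "i' < 3" "i \<noteq> i'"
  shows "up G j \<longleftrightarrow> i' = (i + 2) mod 3"
proof -
  have "if right G j then tile_side T zs j East = tile_side T zs (j + 1) West
      else tile_side T zs j North = tile_side T zs (j + 1) South"
    using assms(1-3) by (auto simp: is_snake_graph_of_def Suc_le_eq)
  moreover note tile_side_NE[of T zs j, OF assms(4)] tile_side_SW[of zs "j + 1" t i' T]
  ultimately show ?thesis
    using assms(5) less_3_cases[OF assms(6)] less_3_cases[OF assms(7)] assms(8)
    by (cases "odd j"; cases "right G j") (auto simp: up_def)
qed

text \<open>The three turns are those inside a hook, from a hook to the arc, and from the arc to a
  hook. The last two go around another corner than \<open>C\<close>, in the sense opposite to the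
  hook; this makes the step next to a hook point against it.\<close>

lemma up_turn_cases:
  assumes "is_snake_graph_of T zs G" "0 < j" "j < ntiles G" "snd C < 3"
  shows "\<lbrakk>opp_side T (zs ! (j - 1)) = spoke (\<not> b) C; zs ! j = spoke b C\<rbrakk> \<Longrightarrow> up G j \<longleftrightarrow> b"
    "\<lbrakk>opp_side T (zs ! (j - 1)) = spoke (\<not> b) C; zs ! j = far_side C\<rbrakk> \<Longrightarrow> up G j \<longleftrightarrow> \<not> b"
    "\<lbrakk>opp_side T (zs ! (j - 1)) = far_side C; zs ! j = spoke (\<not> b) C\<rbrakk> \<Longrightarrow> up G j \<longleftrightarrow> b"
proof -
  obtain t m where C: "C = (t, m)" "m < 3" using assms(4) by (cases C) auto
  note turn = up_iff_turn[OF assms(1-3), of t]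
  show "\<lbrakk>opp_side T (zs ! (j - 1)) = spoke (\<not> b) C; zs ! j = spoke b C\<rbrakk> \<Longrightarrow> up G j \<longleftrightarrow> b"
    using turn[of "snd (spoke (\<not> b) C)" "snd (spoke b C)"] C less_3_cases[OF C(2)] by (cases b) auto
  show "\<lbrakk>opp_side T (zs ! (j - 1)) = spoke (\<not> b) C; zs ! j = far_side C\<rbrakk> \<Longrightarrow> up G j \<longleftrightarrow> \<not> b"
    using turn[of "snd (spoke (\<not> b) C)" "snd (far_side C)"] C less_3_cases[OF C(2)] by (cases b) auto
  show "\<lbrakk>opp_side T (zs ! (j - 1)) = far_side C; zs ! j = spoke (\<not> b) C\<rbrakk> \<Longrightarrow> up G j \<longleftrightarrow> b"
    using turn[of "snd (far_side C)" "snd (spoke (\<not> b) C)"] C less_3_cases[OF C(2)] by (cases b) auto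
qed

lemma crossing_segments:
  assumes "m < 3" and p: "0 < p" "p < 1" and q: "0 < q" "q \<le> 1" and r: "0 < r" "r \<le> 1"
  defines "A \<equiv> corner_point m" and "B \<equiv> corner_point ((m + 1) mod 3)" and
    "D \<equiv> corner_point ((m + 2) mod 3)"
  shows "\<not> closed_segment A ((1 - p) *\<^sub>R B + p *\<^sub>R D) \<inter>
    closed_segment ((1 - q) *\<^sub>R A + q *\<^sub>R B) ((1 - r) *\<^sub>R A + r *\<^sub>R D) \<subseteq> corner_point ` {0, 1, 2}"
proof
  assume sub: "closed_segment A ((1 - p) *\<^sub>R B + p *\<^sub>R D) \<inter>
    closed_segment ((1 - q) *\<^sub>R A + q *\<^sub>R B) ((1 - r) *\<^sub>R A + r *\<^sub>R D) \<subseteq> corner_point ` {0, 1, 2}"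
  define n where "n = q * p + r * (1 - p)"
  \<comment> \<open>This solves \<open>(1 - u) * q * p = u * r * (1 - p)\<close>: the weights at
    \<open>B\<close> and \<open>D\<close> have to be in the ratio of \<open>1 - p\<close> to
    \<open>p\<close>.\<close>
  define u where "u = q * p / n"
  define \<beta> where "\<beta> = (1 - u) * q"
  define \<delta> where "\<delta> = u * r"
  have n: "0 < n" using p q r by (simp add: n_def add_pos_pos)
  have u: "0 < u" "u < 1" using p q r n by (simp_all add: u_def n_def)
  have \<beta>: "0 < \<beta>" and \<delta>: "0 < \<delta>" using u q r by (simp_all add: \<beta>_def \<delta>_def)
  have le: "\<beta> + \<delta> \<le> 1"
  proof -
    have "\<beta> \<le> 1 - u" "\<delta> \<le> u" using u q r by (simp_all add: \<beta>_def \<delta>_def mult_left_le)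
    then show ?thesis by simp
  qed
  have one_minus_u: "1 - u = r * (1 - p) / n" using n
    by (simp add: u_def field_simps) (simp add: n_def algebra_simps)
  have \<beta>': "\<beta> = (\<beta> + \<delta>) * (1 - p)" and \<delta>': "\<delta> = (\<beta> + \<delta>) * p"
    unfolding \<beta>_def \<delta>_def one_minus_u unfolding u_def using n by (simp_all add: field_simps)
  define z where "z = (1 - \<beta> - \<delta>) *\<^sub>R A + \<beta> *\<^sub>R B + \<delta> *\<^sub>R D"
  have "z = (1 - (\<beta> + \<delta>)) *\<^sub>R A + (\<beta> + \<delta>) *\<^sub>R ((1 - p) *\<^sub>R B + p *\<^sub>R D)"
    unfolding scaleR_add_right scaleR_scaleR \<beta>'[symmetric] \<delta>'[symmetric] z_def
      by (simp add: diff_diff_eq)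
  then have "z \<in> closed_segment A ((1 - p) *\<^sub>R B + p *\<^sub>R D)"
    using \<beta> \<delta> le unfolding closed_segment_def by (intro CollectI exI[of _ "\<beta> + \<delta>"]) simp
  moreover have "z = (1 - u) *\<^sub>R ((1 - q) *\<^sub>R A + q *\<^sub>R B) + u *\<^sub>R ((1 - r) *\<^sub>R A + r *\<^sub>R D)"
    unfolding z_def \<beta>_def \<delta>_def by (simp add: algebra_simps)
  then have "z \<in> closed_segment ((1 - q) *\<^sub>R A + q *\<^sub>R B) ((1 - r) *\<^sub>R A + r *\<^sub>R D)"
    using u unfolding closed_segment_def by (intro CollectI exI[of _ u]) simp
  ultimately have "z \<in> corner_point ` {0, 1, 2}" using sub by blast
  moreover have "z \<notin> corner_point ` {0, 1, 2}"
  proof -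
    have corners: "fst c + snd c = 0 \<or> (fst c = 0 \<and> snd c = 1) \<or> (fst c = 1 \<and> snd c = 0)"
      if "c \<in> corner_point ` {0, 1, 2}" for c
      using that by (auto simp: corner_point_def)
    consider "z = (\<beta>, \<delta>)" | "z = (1 - \<beta> - \<delta>, \<beta>)" | "z = (\<delta>, 1 - \<beta> - \<delta>)"
      using less_3_cases[OF assms(1)] unfolding z_def A_def B_def D_def corner_point_def
      by (elim disjE) simp_all
    then have "fst z = \<beta> \<and> snd z = \<delta> \<or> fst z = 1 - \<beta> - \<delta> \<and> snd z = \<beta> \<or> fst z = \<delta> \<and> snd z = 1 - \<beta> - \<delta>"
      by cases simp_all
    then show ?thesis using corners[of z] \<beta> \<delta> le by argo
  qed
  ultimately show False by blast
qed

locale triangulated_surface =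
  fixes T :: "'t triangulation"
  assumes ideal: "ideal_triangulation T"
begin

section \<open>Rotation about punctures\<close>

lemma glue_props:
  assumes "glue T s \<noteq> None"
  shows "s \<in> tris T \<times> {0..<3}" "opp_side T s \<in> tris T \<times> {0..<3}"
    "glue T (opp_side T s) = Some s" "opp_side T (opp_side T s) = s"
proof -
  obtain s' where s': "glue T s = Some s'" using assms by blast
  then have "s \<in> tris T \<times> {0..<3} \<and> s' \<in> tris T \<times> {0..<3} \<and> glue T s' = Some s"
    using ideal unfolding ideal_triangulation_def by blast
  then show "s \<in> tris T \<times> {0..<3}" "opp_side T s \<in> tris T \<times> {0..<3}"
    "glue T (opp_side T s) = Some s" "opp_side T (opp_side T s) = s" using s' by auto
qed

lemma opp_spoke:
  assumes "glue T (spoke b D) \<noteq> None"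
  shows "opp_side T (spoke b D) = spoke (\<not> b) (rotate_corner T b D)"
    "rotate_corner T b D \<in> tris T \<times> {0..<3}"
proof -
  obtain t j where o: "opp_side T (spoke b D) = (t, j)" "t \<in> tris T" "j < 3"
    using glue_props(2)[OF assms] by (cases "opp_side T (spoke b D)") auto
  show "opp_side T (spoke b D) = spoke (\<not> b) (rotate_corner T b D)"
    "rotate_corner T b D \<in> tris T \<times> {0..<3}"
    using o less_3_cases[OF o(3)] by (auto simp: rotate_corner_def)
qed

lemma rotate_back:
  assumes "glue T (spoke b D) \<noteq> None" "snd D < 3"
  shows "rotate_corner T (\<not> b) (rotate_corner T b D) = D"
proof -
  obtain t m where D: "D = (t, m)" "m < 3" using assms(2) by (cases D) auto
  have "opp_side T (spoke (\<not> b) (rotate_corner T b D)) = spoke b D"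
    using opp_spoke(1)[OF assms(1)] glue_props(4)[OF assms(1)] by simp
  then show ?thesis
    unfolding rotate_corner_def[of T "\<not> b"] using D less_3_cases[OF D(2)] by (auto simp: Let_def)
qed

lemma orbit:
  assumes "at_puncture T C" "C \<in> tris T \<times> {0..<3}"
  shows "(rotate_corner T b ^^ n) C \<in> tris T \<times> {0..<3}"
    "glue T (spoke b' ((rotate_corner T b ^^ n) C)) \<noteq> None"
proof -
  have *: "(C, (rotate_corner T b ^^ n) C) \<in> same_vertex T \<and> (rotate_corner T b ^^ n) C
    \<in> tris T \<times> {0..<3}" for n
  proof (induction n)
    case 0 then show ?case using assms(2) by (simp add: same_vertex_def)
  next
    case (Suc n)
    let ?D = "(rotate_corner T b ^^ n) C"
    have "glue T (spoke b ?D) \<noteq> None" using assms(1) Suc unfolding at_puncture_def by blast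
    then have "(?D, rotate_corner T b ?D)
      \<in> {(C, rotate_corner T ccw C) | C ccw. glue T (spoke ccw C) \<noteq> None}"
      by blast
    then have "(C, rotate_corner T b ?D) \<in> same_vertex T"
      using Suc unfolding same_vertex_def by (blast intro: rtrancl_into_rtrancl)
    then show ?case using opp_spoke(2)[OF \<open>glue T (spoke b ?D) \<noteq> None\<close>] by simp
  qed
  show "(rotate_corner T b ^^ n) C \<in> tris T \<times> {0..<3}" using * by blast
  show "glue T (spoke b' ((rotate_corner T b ^^ n) C)) \<noteq> None"
    using * assms(1) unfolding at_puncture_def by blast
qed

text \<open>There are finitely many corners and rotation can be undone, so the first repetition can
  be shifted back to \<open>C\<close>. This gives meaning to the \<open>LEAST\<close> in
  \<open>turn\<close>.\<close>

lemma orbit_returns: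
  assumes "at_puncture T C" "C \<in> tris T \<times> {0..<3}"
  shows "\<exists>n>0. (rotate_corner T b ^^ n) C = C"
proof -
  let ?f = "\<lambda>n. (rotate_corner T b ^^ n) C"
  have "range ?f \<subseteq> tris T \<times> {0..<3}" using orbit(1)[OF assms] by blast
  moreover have "finite (tris T \<times> {0..<3::nat})" using ideal by (simp add: ideal_triangulation_def)
  ultimately have "finite (range ?f)" by (rule finite_subset)
  then have "\<not> inj ?f" using finite_imageD infinite_UNIV_nat by blast
  then obtain i j where ij: "i < j" "?f i = ?f j" unfolding inj_def by (metis linorder_neqE_nat)
  have backwards: "(rotate_corner T (\<not> b) ^^ i) (?f (i + k)) = ?f k" for i k
  proof (induction i)
    case (Suc i)
    have "(rotate_corner T (\<not> b) ^^ Suc i) (?f (Suc i + k))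
        = (rotate_corner T (\<not> b) ^^ i) (rotate_corner T (\<not> b) (rotate_corner T b (?f (i + k))))"
      by (simp add: funpow_swap1)
    also have "\<dots> = (rotate_corner T (\<not> b) ^^ i) (?f (i + k))"
      using rotate_back[OF orbit(2)[OF assms, where b = b and b' = b and n = "i + k"]]
        orbit(1)[OF assms, where b = b and n = "i + k"] by auto
    finally show ?case using Suc by simp
  qed simp
  have "?f (j - i) = ?f 0" using backwards[of i 0] backwards[of i "j - i"] ij by simp
  then show ?thesis using ij(1) by (intro exI[of _ "j - i"]) simp
qed

text \<open>A turn of length 1 would map \<open>C\<close> to itself, so the two sides at
  \<open>C\<close> would be glued to each other.\<close>

lemma turn_props:
  assumes "at_puncture T C" "C \<in> tris T \<times> {0..<3}"
  shows "(rotate_corner T b ^^ length (turn T b C)) C = C" "0 < length (turn T b C)"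
    "\<not> enclosed_by_self_folded T C \<Longrightarrow> 2 \<le> length (turn T b C)"
proof -
  let ?P = "\<lambda>n. 0 < n \<and> (rotate_corner T b ^^ n) C = C"
  have len: "length (turn T b C) = (LEAST n. ?P n)" by (simp add: turn_def)
  have least: "?P (length (turn T b C))"
    unfolding len using orbit_returns[OF assms] by (rule LeastI_ex)
  then show "(rotate_corner T b ^^ length (turn T b C)) C = C" "0 < length (turn T b C)" by auto
  show "2 \<le> length (turn T b C)" if "\<not> enclosed_by_self_folded T C"
  proof (rule ccontr)
    assume "\<not> ?thesis"
    then have "length (turn T b C) = 1" using least by linarith
    then have "rotate_corner T b C = C" using least by simp
    moreover have glued: "glue T (spoke b C) \<noteq> None" using orbit(2)[OF assms, where n = 0] by simp
    ultimately have "opp_side T (spoke b C) = spoke (\<not> b) C" using opp_spoke(1)[OF glued] by simp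
    then have "glue T (spoke b C) = Some (spoke (\<not> b) C)" "glue T (spoke (\<not> b) C) = Some (spoke b C)"
      using glued glue_props(3)[OF glued] by auto
    then show False using that by (cases b) (auto simp: enclosed_by_self_folded_def)
  qed
qed

lemma turn_nth:
  assumes "at_puncture T C" "C \<in> tris T \<times> {0..<3}" "r < length (turn T b C)"
  shows "turn T b C ! r = spoke b ((rotate_corner T b ^^ r) C)"
    "opp_side T (turn T b C ! r) = spoke (\<not> b) ((rotate_corner T b ^^ Suc r) C)"
    "glue T (turn T b C ! r) \<noteq> None"
proof -
  show nth: "turn T b C ! r = spoke b ((rotate_corner T b ^^ r) C)"
    using assms(3) by (simp add: turn_def)
  show "glue T (turn T b C ! r) \<noteq> None" using nth orbit(2)[OF assms(1,2)] by simp
  show "opp_side T (turn T b C ! r) = spoke (\<not> b) ((rotate_corner T b ^^ Suc r) C)"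
    unfolding nth using opp_spoke(1)[OF orbit(2)[OF assms(1,2)]] by simp
qed

section \<open>Reversal of arcs, which makes the second end a start\<close>

lemma reverse_list_nth:
  assumes "i < length xs"
  shows "reverse_list T xs ! i = opp_side T (xs ! (length xs - 1 - i))"
  using assms by (simp add: reverse_list_def rev_nth)

lemma start_corner_reverse:
  assumes "xs \<noteq> []"
  shows "hd (reverse_list T xs) = opp_side T (last xs)"
    "start_corner (reverse_list T xs) = end_corner T xs"
proof -
  show "hd (reverse_list T xs) = opp_side T (last xs)"
    using assms by (simp add: reverse_list_def hd_rev last_map)
  then show "start_corner (reverse_list T xs) = end_corner T xs"
    by (simp add: start_corner_def end_corner_def)
qed

lemma crossing_list_reverse:
  assumes "crossing_list T xs"
  shows "crossing_list T (reverse_list T xs)"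
  unfolding crossing_list_def
proof (intro conjI allI impI ballI)
  show "reverse_list T xs \<noteq> []" using assms by (simp add: crossing_list_def reverse_list_def)
  fix s assume "s \<in> set (reverse_list T xs)"
  then obtain x where "x \<in> set xs" "s = opp_side T x" by (auto simp: reverse_list_def)
  then show "glue T s \<noteq> None" using assms glue_props(3)[of x] by (auto simp: crossing_list_def)
next
  fix i assume "i + 1 < length (reverse_list T xs)"
  then have i: "i + 1 < length xs" by (simp add: reverse_list_def)
  define j where "j = length xs - 2 - i"
  have j: "j + 1 < length xs" "length xs - 1 - i = j + 1" "length xs - 1 - (i + 1) = j"
    using i by (auto simp: j_def)
  have "glue T (xs ! (j + 1)) \<noteq> None" using assms j(1) by (simp add: crossing_list_def)
  then have "reverse_list T xs ! (i + 1) = opp_side T (xs ! j)"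
    "opp_side T (reverse_list T xs ! i) = xs ! (j + 1)"
    using reverse_list_nth[of i xs] reverse_list_nth[of "i + 1" xs] i j glue_props(4) by auto
  moreover have "fst (xs ! (j + 1)) = fst (opp_side T (xs ! j)) \<and> xs ! (j + 1) \<noteq> opp_side T (xs ! j)"
    using assms j(1) by (simp add: crossing_list_def)
  ultimately show "fst (reverse_list T xs ! (i + 1)) = fst (opp_side T (reverse_list T xs ! i))"
    "reverse_list T xs ! (i + 1) \<noteq> opp_side T (reverse_list T xs ! i)" by auto
qed

lemma non_self_crossing_reverse:
  assumes xs: "crossing_list T xs" and "non_self_crossing T xs"
  shows "non_self_crossing T (reverse_list T xs)"
proof -
  let ?n = "length xs" and ?ys = "reverse_list T xs"
  obtain p where p: "\<And>i. i < ?n \<Longrightarrow> 0 < p i \<and> p i < 1"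
    and disj: "\<And>i j. \<lbrakk>i \<le> ?n; j \<le> ?n; i \<noteq> j; segment_tri T xs i = segment_tri T xs j\<rbrakk> \<Longrightarrow>
      segment T xs p i \<inter> segment T xs p j \<subseteq> corner_point ` {0, 1, 2}"
    using assms(2) unfolding non_self_crossing_def by blast
  \<comment> \<open>Glued sides have opposite directions, so positions become complementary.\<close>
  define p' where "p' i = 1 - p (?n - 1 - i)" for i
  have len: "length ?ys = ?n" by (simp add: reverse_list_def)
  have ne: "xs \<noteq> []" "?ys \<noteq> []" using xs by (auto simp: crossing_list_def reverse_list_def)
  have glued: "glue T (xs ! i) \<noteq> None" if "i < ?n" for i using xs that by (simp add: crossing_list_def)
  have ys: "?ys ! i = opp_side T (xs ! (?n - 1 - i))" "opp_side T (?ys ! i) = xs ! (?n - 1 - i)"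
    if "i < ?n" for i
    using reverse_list_nth[OF that] glue_props(4)[OF glued[of "?n - 1 - i"]] that by auto
  have last_ys: "opp_side T (last ?ys) = hd xs"
    using ys(2)[of "?n - 1"] ne len by (simp add: last_conv_nth hd_conv_nth)
  have tri: "segment_tri T ?ys i = segment_tri T xs (?n - i)" if i: "i \<le> ?n" for i
  proof (cases "i = 0")
    case True
    then show ?thesis using start_corner_reverse(1)[OF ne(1)] ne
      by (simp add: segment_tri_def last_conv_nth)
  next
    case False
    then have "segment_tri T ?ys i = fst (xs ! (?n - i))" using ys(2)[of "i - 1"] i
      by (simp add: segment_tri_def)
    moreover have "fst (xs ! (?n - i)) = fst (opp_side T (xs ! (?n - i - 1)))" if "i < ?n"
    proof -
      have "?n - i - 1 + 1 < length xs" "?n - i - 1 + 1 = ?n - i" using that False by auto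
      then show ?thesis using xs unfolding crossing_list_def by metis
    qed
    ultimately show ?thesis using i False ne by (auto simp: segment_tri_def hd_conv_nth)
  qed
  have seg: "segment T ?ys p' i = segment T xs p (?n - i)" if i: "i \<le> ?n" for i
  proof -
    have start: "(if i = 0 then corner_point (snd (start_corner ?ys))
        else side_point (snd (opp_side T (?ys ! (i - 1)))) (1 - p' (i - 1)))
      = (if ?n - i = ?n then corner_point (snd (end_corner T xs)) else side_point (snd (xs ! (?n - i)))
        (p (?n - i)))"
      using i ne start_corner_reverse(2)[OF ne(1)] ys(2)[of "i - 1"] by (auto simp: p'_def)
    have finish:
      "(if i = length ?ys then corner_point (snd (end_corner T ?ys))
      else side_point (snd (?ys ! i)) (p' i))
      = (if ?n - i = 0 then corner_point (snd (start_corner xs))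
         else side_point (snd (opp_side T (xs ! (?n - i - 1)))) (1 - p (?n - i - 1)))"
      using i len last_ys ys(1)[of i]
        by (auto simp: p'_def end_corner_def start_corner_def diff_right_commute)
    show ?thesis unfolding segment_def start finish by (rule closed_segment_commute)
  qed
  show ?thesis
    unfolding non_self_crossing_def len
  proof (intro exI[of _ p'] conjI allI impI)
    fix i assume "i < ?n"
    then show "0 < p' i" "p' i < 1" using p[of "?n - 1 - i"] by (auto simp: p'_def)
  next
    fix i j assume ij: "i \<le> ?n" "j \<le> ?n" "i \<noteq> j \<and> segment_tri T ?ys i = segment_tri T ?ys j"
    then have "?n - i \<noteq> ?n - j" by auto
    with ij show "segment T ?ys p' i \<inter> segment T ?ys p' j \<subseteq> corner_point ` {0, 1, 2}"
      using disj[of "?n - i" "?n - j"] tri[of i] tri[of j] seg[of i] seg[of j] by auto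
  qed
qed

text \<open>If the first side crossed were glued to a side at the starting corner, then the arc would
  return to its first triangle through that side.  It may cross the first side again several times,
  but eventually it ends in this triangle or leaves it through the other side at the starting corner,
  and that segment crosses the first one.\<close>

lemma first_side_not_glued_to_spoke:
  assumes xs: "crossing_list T xs" and nsc: "non_self_crossing T xs"
  shows "glue T (hd xs) \<noteq> Some (spoke b (start_corner xs))"
proof
  assume fold: "glue T (hd xs) = Some (spoke b (start_corner xs))"
  let ?n = "length xs"
  obtain p where p: "\<And>i. i < ?n \<Longrightarrow> 0 < p i \<and> p i < 1"
    and disj: "\<And>i j. \<lbrakk>i \<le> ?n; j \<le> ?n; i \<noteq> j; segment_tri T xs i = segment_tri T xs j\<rbrakk> \<Longrightarrow>
      segment T xs p i \<inter> segment T xs p j \<subseteq> corner_point ` {0, 1, 2}"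
    using nsc unfolding non_self_crossing_def by blast
  have ne: "xs \<noteq> []" using xs by (simp add: crossing_list_def)
  obtain t m where C: "start_corner xs = (t, m)" "m < 3"
    using opposite_corner_less_3[of "hd xs"] by (cases "start_corner xs") (auto simp: start_corner_def)
  have hd_less: "snd (hd xs) < 3" using fold glue_props(1)[of "hd xs"] by auto
  then have hd: "hd xs = (t, (m + 1) mod 3)"
    using far_side_opposite_corner[of "hd xs"] C by (simp add: start_corner_def)
  \<comment> \<open>The first segment after the start that does not leave through the first side
    again.\<close>
  define i where "i = (LEAST i. 0 < i \<and> (i = ?n \<or> xs ! i \<noteq> hd xs))"
  have "0 < ?n \<and> (?n = ?n \<or> xs ! ?n \<noteq> hd xs)" using ne by simp
  then have i: "0 < i" "i = ?n \<or> xs ! i \<noteq> hd xs" "i \<le> ?n"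
    unfolding i_def
      by (metis (mono_tags, lifting) LeastI, metis (mono_tags, lifting) LeastI, metis (mono_tags,
      lifting) Least_le)
  have "xs ! (i - 1) = hd xs"
  proof (cases "i - 1 = 0")
    case True then show ?thesis using ne by (simp add: hd_conv_nth)
  next
    case False
    then show ?thesis using not_less_Least[of "i - 1" "\<lambda>i. 0 < i \<and> (i = ?n \<or> xs ! i \<noteq> hd xs)"] i
      by (auto simp: i_def[symmetric])
  qed
  then have prev: "opp_side T (xs ! (i - 1)) = spoke b (t, m)" using fold C by simp
  have seg0: "segment T xs p 0 = closed_segment (corner_point m)
      ((1 - p 0) *\<^sub>R corner_point ((m + 1) mod 3) + p 0 *\<^sub>R corner_point ((m + 2) mod 3))"
    using ne C hd less_3_cases[OF C(2)]
      by (auto simp: segment_def side_point_def hd_conv_nth[symmetric])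
  \<comment> \<open>The first side is excluded by the choice of \<open>i\<close>, the side of entry
    by minimal position; the other side at the corner remains.\<close>
  have next_side: "xs ! i = (t, if b then m else (m + 2) mod 3)" if "i \<noteq> ?n"
  proof -
    have "i < ?n" using that i by simp
    then have "glue T (xs ! i) \<noteq> None" using xs by (simp add: crossing_list_def)
    then have "snd (xs ! i) < 3" using glue_props(1)[of "xs ! i"] by (cases "xs ! i") auto
    moreover have "i - 1 + 1 < ?n" "i - 1 + 1 = i" using \<open>i < ?n\<close> i by auto
    then have "fst (xs ! i) = t" "xs ! i \<noteq> spoke b (t, m)"
      using xs prev unfolding crossing_list_def by (metis fst_conv spoke.simps)+
    ultimately show ?thesis
      using i(2) that hd less_3_cases[OF C(2)] by (cases "xs ! i") (auto dest!: less_3_cases)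
  qed
  have p0: "0 < p 0" "p 0 < 1" using p[of 0] ne by auto
  have pprev: "0 < p (i - 1)" "p (i - 1) < 1" using p[of "i - 1"] i by auto
  have seg_i: "\<exists>q r. 0 < q \<and> q \<le> 1 \<and> 0 < r \<and> r \<le> 1 \<and> segment T xs p i = closed_segment
      ((1 - q) *\<^sub>R corner_point m + q *\<^sub>R corner_point ((m + 1) mod 3))
      ((1 - r) *\<^sub>R corner_point m + r *\<^sub>R corner_point ((m + 2) mod 3))"
  proof -
    \<comment> \<open>The weight of corner \<open>m\<close> in the endpoint of segment
      \<open>i\<close>. It is 0 if the arc ends here, namely at the corner opposite to the side of
      entry.\<close>
    define e where "e = (if i = ?n then 0 else if b then 1 - p i else p i)"
    have e: "0 \<le> e" "e < 1" using p[of i] i by (auto simp: e_def)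
    have start: "side_point (snd (opp_side T (xs ! (i - 1)))) (1 - p (i - 1))
        = (if b then p (i - 1) *\<^sub>R corner_point ((m + 2) mod 3) + (1 - p (i - 1)) *\<^sub>R corner_point m
           else p (i - 1) *\<^sub>R corner_point m + (1 - p (i - 1)) *\<^sub>R corner_point ((m + 1) mod 3))"
      unfolding prev using less_3_cases[OF C(2)] by (auto simp: side_point_def numeral_2_eq_2)
    have finish:
      "(if i = ?n then corner_point (snd (end_corner T xs)) else side_point (snd (xs ! i)) (p i))
        = (if b then e *\<^sub>R corner_point m + (1 - e) *\<^sub>R corner_point ((m + 1) mod 3)
           else (1 - e) *\<^sub>R corner_point ((m + 2) mod 3) + e *\<^sub>R corner_point m)"
    proof (cases "i = ?n")
      case True
      then have "end_corner T xs = opposite_corner (spoke b (t, m))"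
        using prev ne by (simp add: end_corner_def last_conv_nth)
      then show ?thesis using True less_3_cases[OF C(2)] by (auto simp: e_def numeral_2_eq_2)
    next
      case False
      then show ?thesis using next_side less_3_cases[OF C(2)]
        by (auto simp: e_def side_point_def numeral_2_eq_2)
    qed
    have seg: "segment T xs p i = closed_segment
        (side_point (snd (opp_side T (xs ! (i - 1)))) (1 - p (i - 1)))
        (if i = ?n then corner_point (snd (end_corner T xs)) else side_point (snd (xs ! i)) (p i))"
      using i(1) by (simp add: segment_def)
    show ?thesis
    proof (cases b)
      case True
      then show ?thesis unfolding seg start finish using e pprev
        by (intro exI[of _ "1 - e"] exI[of _
          "p (i - 1)"]) (simp add: closed_segment_commute add.commute)
    next
      case False
      then show ?thesis unfolding seg start finish using e pprev
        by (intro exI[of _ "1 - p (i - 1)"] exI[of _ "1 - e"]) (simp add: add.commute)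
    qed
  qed
  have "segment_tri T xs 0 = segment_tri T xs i"
    using hd prev i(1) by (simp add: segment_tri_def)
  then have "segment T xs p 0 \<inter> segment T xs p i \<subseteq> corner_point ` {0, 1, 2}"
    using disj[of 0 i] i by simp
  then show False
    using seg_i crossing_segments[OF C(2) p0] unfolding seg0 by metis
qed

text \<open>Equal labels mean that the sides are equal or glued. This will exclude the wrong
  position of the outer cut edge, which comes from the first side crossed by the arc.\<close>

lemma label_far_side:
  assumes xs: "crossing_list T xs" and nsc: "non_self_crossing T xs"
  shows "label T (hd xs) \<noteq> label T (spoke b (start_corner xs))"
proof
  assume eq: "label T (hd xs) = label T (spoke b (start_corner xs))"
  have g: "glue T (hd xs) \<noteq> None" using xs by (simp add: crossing_list_def)
  then have "snd (hd xs) < 3" using glue_props(1) by (cases "hd xs") fastforce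
  then have "hd xs \<noteq> spoke b (start_corner xs)"
    using far_side_opposite_corner[of "hd xs"] far_side_not_spoke[of
      "start_corner xs" b] opposite_corner_less_3[of "hd xs"]
    by (simp add: start_corner_def)
  moreover have "spoke b (start_corner xs) \<in> label T (hd xs)" unfolding eq by (simp add: label_def)
  ultimately have "glue T (hd xs) = Some (spoke b (start_corner xs))" using g by (auto simp: label_def)
  then show False using first_side_not_glued_to_spoke[OF xs nsc] by blast
qed

lemma start_corner_in_tris:
  assumes "crossing_list T xs"
  shows "start_corner xs \<in> tris T \<times> {0..<3}"
proof -
  have "glue T (hd xs) \<noteq> None" using assms by (simp add: crossing_list_def)
  then have "hd xs \<in> tris T \<times> {0..<3}" by (rule glue_props(1))
  then show ?thesis by (cases "hd xs") (auto simp: start_corner_def)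
qed

lemma hd_far_side: "crossing_list T xs \<Longrightarrow> hd xs = far_side (start_corner xs)"
proof -
  assume "crossing_list T xs"
  then have "hd xs \<in> tris T \<times> {0..<3}" using glue_props(1)[of "hd xs"] by (auto simp: crossing_list_def)
  then have "snd (hd xs) < 3" by auto
  then show ?thesis by (simp add: start_corner_def far_side_opposite_corner)
qed

text \<open>The second hook is a turn at the start of the reversed arc \<open>ys\<close>, so both
  ends reduce to a rotation about a starting corner.\<close>

lemma surface_loop_graph_shape:
  assumes "surface_loop_graph T G"
  shows "loop_shape G"
proof -
  obtain xs nt1 nt2 o1 o2 zs where tagged: "tagged_arc T xs nt1 nt2"
    and free1: "nt1 \<longrightarrow> \<not> enclosed_by_self_folded T (start_corner xs)"
    and free2: "nt2 \<longrightarrow> \<not> enclosed_by_self_folded T (end_corner T xs)"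
    and zs: "zs = hooked_arc T nt1 nt2 o1 o2 xs" and snake: "is_snake_graph_of T zs G"
    and k1: "k1 G = length (hook T nt1 o1 xs) + 1"
    and k2: "k2 G = length (hook T nt1 o1 xs) + length xs"
    and cut1: "has_loop1 G \<longrightarrow> cut1 G \<in> {South, West} \<and>
       label T (tile_side T zs 1 (cut1 G)) = label T (tile_side T zs (k1 G) (inner_cut1 G))"
    and cut2: "has_loop2 G \<longrightarrow> cut2 G \<in> {North, East} \<and>
       label T (tile_side T zs (ntiles G) (cut2 G)) = label T (tile_side T zs (k2 G) (inner_cut2 G))"
    using assms unfolding surface_loop_graph_def by blast
  define H where "H = hook T nt1 o1 xs"
  define ys where "ys = reverse_list T xs"
  define K where "K = hook T nt2 o2 ys"
  let ?C = "start_corner xs" and ?D = "start_corner ys"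
  have xs: "crossing_list T xs" "non_self_crossing T xs" using tagged by (auto simp: tagged_arc_def)
  have ne: "xs \<noteq> []" using xs(1) by (simp add: crossing_list_def)
  have ys: "crossing_list T ys" "non_self_crossing T ys"
    unfolding ys_def using crossing_list_reverse non_self_crossing_reverse xs by auto
  have D: "?D = end_corner T xs" "hd ys = opp_side T (last xs)"
    unfolding ys_def using start_corner_reverse[OF ne] by auto
  have corners: "?C \<in> tris T \<times> {0..<3}" "?D \<in> tris T \<times> {0..<3}"
    using start_corner_in_tris xs ys by auto
  then have less3: "snd ?C < 3" "snd ?D < 3" by auto
  have zs': "zs = H @ xs @ reverse_list T K"
    unfolding zs hooked_arc_def H_def K_def ys_def ..
  have len: "ntiles G = length H + length xs + length K" "k1 G = length H + 1"
    "k2 G = length H + length xs"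
    using snake k1 k2 unfolding zs' is_snake_graph_of_def H_def by (auto simp: reverse_list_def)
  have n: "0 < length xs" using ne by simp
  have loops: "has_loop1 G \<longleftrightarrow> H \<noteq> []" "has_loop2 G \<longleftrightarrow> K \<noteq> []"
    using len by (auto simp: has_loop1_def has_loop2_def)
  show ?thesis
  proof
    show "1 \<le> k1 G" "k1 G \<le> k2 G" "k2 G \<le> ntiles G" using len n by linarith+
  next
    assume L: "has_loop1 G"
    then have nt: "nt1" using loops by (auto simp: H_def hook_def split: if_splits)
    then have H: "H = turn T o1 ?C" by (simp add: H_def hook_def)
    have p: "at_puncture T ?C" using tagged nt by (simp add: tagged_arc_def)
    have long: "2 \<le> length H" using turn_props(3)[OF p corners(1)] free1 nt H by simp
    then show "3 \<le> k1 G" using len by simp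
    define R where "R l = (rotate_corner T o1 ^^ l) ?C" for l
    have R: "R 0 = ?C" "R (length H) = ?C" "snd (R l) < 3" for l
      using turn_props(1)[OF p corners(1)] orbit(1)[OF p corners(1), where b = o1 and n = l] H
      by (auto simp: R_def)
    have zs_H: "zs ! l = spoke o1 (R l)" "opp_side T (zs ! l) = spoke (\<not> o1) (R (Suc l))"
      if "l < length H" for l
      using that turn_nth[OF p corners(1), of l o1] unfolding zs' H R_def by (auto simp: nth_append)
    have zs_xs: "zs ! length H = far_side ?C"
      using hd_far_side[OF xs(1)] ne by (simp add: zs' nth_append hd_conv_nth)
    have up_hook: "up G l \<longleftrightarrow> o1" if "0 < l" "l < length H" for l
    proof (rule up_turn_cases(1)[OF snake that(1) _ R(3)[of l]])
      show "opp_side T (zs ! (l - 1)) = spoke (\<not> o1) (R l)" using zs_H(2)[of "l - 1"] that by simp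
    qed (use that zs_H len in auto)
    have up_end: "up G (k1 G - 1) \<longleftrightarrow> \<not> o1"
    proof -
      have last: "Suc (length H - 1) = length H" using long by simp
      have "up G (length H) \<longleftrightarrow> \<not> o1"
      proof (rule up_turn_cases(2)[OF snake _ _ less3(1)])
        show "opp_side T (zs ! (length H - 1)) = spoke (\<not> o1) ?C"
          using zs_H(2)[of "length H - 1"] R(2) last by simp
      qed (use long len n zs_xs in auto)
      then show ?thesis using len by simp
    qed
    show "up G l \<longleftrightarrow> \<not> up G (k1 G - 1)" if "0 < l" "Suc l < k1 G" for l
      using up_hook[of l] up_end that len by simp
    obtain t m where C: "?C = (t, m)" "m < 3" using less3 by (cases ?C) auto
    \<comment> \<open>In the triangle of the starting corner, tile \<open>k1\<close> has the far
      side as diagonal and shares \<open>spoke o1\<close> with the preceding tile, so the other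
      spoke is the cut edge.\<close>
    have inner: "tile_side T zs (k1 G) (inner_cut1 G) = spoke (\<not> o1) ?C"
    proof -
      have "zs ! (k1 G - 1) = (t, (m + 1) mod 3)" using zs_xs C len by simp
      note tile_side_SW[of zs "k1 G", OF this]
      moreover have "right G (k1 G - 1) \<longleftrightarrow> (odd (k1 G) \<longleftrightarrow> o1)"
        using up_end len long by (auto simp: up_def)
      ultimately show ?thesis
        using C less_3_cases[OF C(2)] by (cases o1; cases "odd (k1 G)") (auto simp: inner_cut1_def)
    qed
    have outer: "tile_side T zs 1 (if o1 then South else West) = far_side ?C"
    proof -
      have "0 < length H" using long by linarith
      then have "zs ! (1 - 1) = (t, snd (spoke o1 ?C))" using zs_H(1)[of 0] R(1) C by (cases o1) auto
      from tile_side_SW[OF this] show ?thesis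
        using C less_3_cases[OF C(2)] by (cases o1) auto
    qed
    have wrong: "label T (tile_side T zs 1 (if o1 then South else West)) \<noteq> label T (spoke (\<not> o1) ?C)"
      using label_far_side[OF xs] hd_far_side[OF xs(1)] unfolding outer by simp
    have cut: "label T (tile_side T zs 1 (cut1 G)) = label T (spoke (\<not> o1) ?C)"
      using cut1 L inner by simp
    have "cut1 G \<noteq> (if o1 then South else West)"
    proof
      assume eq: "cut1 G = (if o1 then South else West)"
      show False using wrong cut unfolding eq by (rule notE)
    qed
    then show "cut1 G = (if up G (k1 G - 1) then South else West)"
      using cut1 L unfolding up_end by (cases o1) auto
  next
    assume L: "has_loop2 G"
    then have nt: "nt2" using loops by (auto simp: K_def hook_def split: if_splits)
    then have K: "K = turn T o2 ?D" by (simp add: K_def hook_def)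
    have p: "at_puncture T ?D" using tagged nt D by (simp add: tagged_arc_def)
    have long: "2 \<le> length K" using turn_props(3)[OF p corners(2)] free2 nt K D by simp
    then show "k2 G + 2 \<le> ntiles G" using len by simp
    define R where "R l = (rotate_corner T o2 ^^ l) ?D" for l
    have R: "R 0 = ?D" "R (length K) = ?D" "snd (R l) < 3" for l
      using turn_props(1)[OF p corners(2)] orbit(1)[OF p corners(2), where b = o2 and n = l] K
      by (auto simp: R_def)
    have zs_K: "zs ! (k2 G + l) = spoke (\<not> o2) (R (length K - l))"
      "opp_side T (zs ! (k2 G + l)) = spoke o2 (R (length K - 1 - l))" if l: "l < length K" for l
    proof -
      \<comment> \<open>The hook is traversed backwards, hence the reversed index, and every side is
        replaced by the one glued to it.\<close>
      have "zs ! (k2 G + l) = opp_side T (K ! (length K - 1 - l))"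
        using reverse_list_nth[OF l] len by (simp add: zs' nth_append)
      moreover have "length K - 1 - l < length (turn T o2 ?D)" "Suc (length K - 1 - l) = length K - l"
        using l K by auto
      ultimately show "zs ! (k2 G + l) = spoke (\<not> o2) (R (length K - l))"
        "opp_side T (zs ! (k2 G + l)) = spoke o2 (R (length K - 1 - l))"
        using turn_nth[OF p corners(2), of "length K - 1 - l" o2] glue_props(4)[of
          "K ! (length K - 1 - l)"]
        unfolding K[symmetric] R_def by auto
    qed
    have zs_xs: "opp_side T (zs ! (k2 G - 1)) = far_side ?D"
    proof -
      have k2': "k2 G - 1 = length H + (length xs - 1)" using len n by linarith
      have "zs ! (k2 G - 1) = (xs @ reverse_list T K) ! (length xs - 1)"
        unfolding zs' k2' by (rule nth_append_length_plus)
      then have "zs ! (k2 G - 1) = last xs" using ne by (simp add: nth_append last_conv_nth)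
      then show ?thesis using hd_far_side[OF ys(1)] D(2) by simp
    qed
    have up_hook: "up G l \<longleftrightarrow> \<not> o2" if l: "k2 G < l" "l < ntiles G" for l
    proof -
      define i where "i = l - k2 G"
      have i: "l = k2 G + i" "0 < i" "i < length K" "l - 1 = k2 G + (i - 1)" using l len
        by (auto simp: i_def)
      show ?thesis
      \<comment> \<open>A rotation of sense \<open>o2\<close> traversed backwards has sense
        \<open>\<not> o2\<close>.\<close>
      proof (rule up_turn_cases(1)[OF snake _ l(2) R(3)[of "length K - i"]])
        show "zs ! l = spoke (\<not> o2) (R (length K - i))" using zs_K(1)[of i] i by simp
        show "opp_side T (zs ! (l - 1)) = spoke (\<not> \<not> o2) (R (length K - i))"
          using zs_K(2)[of "i - 1"] i by simp
      qed (use i in auto)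
    qed
    have up_end: "up G (k2 G) \<longleftrightarrow> o2"
    proof (rule up_turn_cases(3)[OF snake _ _ less3(2) zs_xs])
      show "zs ! k2 G = spoke (\<not> o2) ?D"
        using zs_K(1)[of 0] R(2) less_le_trans[OF zero_less_numeral long] by simp
    qed (use long len n in auto)
    show "up G l \<longleftrightarrow> \<not> up G (k2 G)" if "k2 G < l" "l < ntiles G" for l
      using up_hook[OF that] up_end by simp
    obtain t m where C: "?D = (t, m)" "m < 3" using less3 by (cases ?D) auto
    have inner: "tile_side T zs (k2 G) (inner_cut2 G) = spoke (\<not> o2) ?D"
    proof -
      have "opp_side T (zs ! (k2 G - 1)) = (t, (m + 1) mod 3)" using zs_xs C by simp
      note tile_side_NE[of T zs "k2 G", OF this]
      moreover have "right G (k2 G) \<longleftrightarrow> (odd (k2 G) \<longleftrightarrow> o2)" using up_end by (auto simp: up_def)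
      ultimately show ?thesis
        using C less_3_cases[OF C(2)] by (cases o2; cases "odd (k2 G)") (auto simp: inner_cut2_def)
    qed
    \<comment> \<open>Unlike the first tile, the last one may be drawn with either orientation,
      hence the parity.\<close>
    let ?wrong = "if o2 = odd (ntiles G) then North else East"
    have outer: "tile_side T zs (ntiles G) ?wrong = far_side ?D"
    proof -
      have pos: "0 < length K" using long by linarith
      then have "ntiles G - 1 = k2 G + (length K - 1)" using len by linarith
      then have "opp_side T (zs ! (ntiles G - 1)) = (t, snd (spoke o2 ?D))"
        using zs_K(2)[of "length K - 1"] R(1) C pos by (cases o2) auto
      from tile_side_NE[OF this] show ?thesis
        using C less_3_cases[OF C(2)] by (cases o2; cases "odd (ntiles G)") auto
    qed
    have wrong: "label T (tile_side T zs (ntiles G) ?wrong) \<noteq> label T (spoke (\<not> o2) ?D)"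
      using label_far_side[OF ys] hd_far_side[OF ys(1)] unfolding outer by simp
    have cut: "label T (tile_side T zs (ntiles G) (cut2 G)) = label T (spoke (\<not> o2) ?D)"
      using cut2 L inner by simp
    have "cut2 G \<noteq> ?wrong"
    proof
      assume eq: "cut2 G = ?wrong"
      show False using wrong cut unfolding eq by (rule notE)
    qed
    then show "cut2 G = (if up G (k2 G) = odd (ntiles G) then East else North)"
      using cut2 L unfolding up_end by (cases "o2 = odd (ntiles G)") auto
  qed
qed

end

theorem theorem7p9:
  fixes T :: "'t triangulation" and G :: loop_graph
  assumes "ideal_triangulation T"
    and "surface_loop_graph T G"
  shows "bij_betw (height G) (good_matchings G) (order_ideals G) \<and>
    (\<forall>P\<in>good_matchings G. \<forall>P'\<in>good_matchings G.
       (P, P') \<in> (twist_arrows G)\<^sup>* \<longleftrightarrow> height G P \<subseteq> height G P') \<and>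
    (\<forall>P\<in>good_matchings G. \<forall>P'\<in>good_matchings G.
       (P, P') \<in> twist_arrows G \<longleftrightarrow>
         height G P \<subset> height G P' \<and>
         \<not> (\<exists>I\<in>order_ideals G. height G P \<subset> I \<and> I \<subset> height G P'))"
proof -
  interpret triangulated_surface T by unfold_locales (rule assms(1))
  interpret loop_shape G by (rule surface_loop_graph_shape[OF assms(2)])
  show ?thesis
    using loop_graph_lattice(1) by (intro conjI ballI loop_graph_lattice(2,3))
qed

end
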